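(* Let $G$ be a simple graph. Then $\hat{\pi}_3(G)=0$ if and only if $G$ satisfies both of the following conditions: (1) $G$ is triangle-free, and there exists a vertex $v\in V(G)$ such that the induced subgraph $G-v$ is bipartite; (2) there exists a bipartite subgraph $B\subseteq G$ with bipartition $(U_1,U_2)$ of $V(G)$ such that the set $E(G)\setminus E(B)$ is a (possibly empty) matching all of whose edges lie inside one and the same part $U_i$ of the bipartition.
   Context: A 3-graph is a hypergraph all of whose edges have exactly 3 vertices. The shadow $\partial(\mathcal{H})$ of a hypergraph $\mathcal{H}$ is the simple graph on $V(\mathcal{H})$ in which $uv$ is an edge iff $\{u,v\}\subseteq h$ for some edge $h$ of $\mathcal{H}$. For a simple graph $G$, a hypergraph $\mathcal{H}$ is a Berge-$G$ if there is an injection $i:V(G)\to V(\mathcal{H})$ and a bijection $f:E(G)\to E(\mathcal{H})$ with $\{i(u),i(v)\}\subseteq f(uv)$ for every $uv\in E(G)$; $\mathcal{H}$ is Berge-$G$-free if no subhypergraph of it is a Berge-$G$. $\hat{\mathrm{ex}}_3(n,G)$ is the maximum number of edges of $\partial(\mathcal{H})$ over all Berge-$G$-free 3-graphs $\mathcal{H}$ on $n$ vertices, and $\hat{\pi}_3(G)=\limsup_{n\to\infty}\hat{\mathrm{ex}}_3(n,G)/\binom{n}{2}$. *)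

theory Defs
  imports Complex_Main "HOL-Library.Extended_Real" "HOL-Library.Disjoint_Sets"
begin

text \<open>Graphs and hypergraphs are pairs of a finite vertex set and a set of edges,
  each edge being a set of vertices.\<close>

definition uniform_hypergraph :: "nat \<Rightarrow> 'a set \<Rightarrow> 'a set set \<Rightarrow> bool" where
  "uniform_hypergraph r V E \<longleftrightarrow> finite V \<and> (\<forall>e\<in>E. e \<subseteq> V \<and> card e = r)"

abbreviation simple_graph :: "'a set \<Rightarrow> 'a set set \<Rightarrow> bool" where
  "simple_graph \<equiv> uniform_hypergraph 2"

abbreviation three_graph :: "'a set \<Rightarrow> 'a set set \<Rightarrow> bool" where
  "three_graph \<equiv> uniform_hypergraph 3"

definition subhypergraph :: "'a set \<Rightarrow> 'a set set \<Rightarrow> 'a set \<Rightarrow> 'a set set \<Rightarrow> bool" where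
  "subhypergraph W' H' W H \<longleftrightarrow> W' \<subseteq> W \<and> H' \<subseteq> H \<and> (\<forall>h\<in>H'. h \<subseteq> W')"

definition shadow :: "'a set \<Rightarrow> 'a set set \<Rightarrow> 'a set set" where
  "shadow W H = {{u, v} | u v. u \<in> W \<and> v \<in> W \<and> u \<noteq> v \<and> (\<exists>h\<in>H. {u, v} \<subseteq> h)}"

definition is_Berge :: "'a set \<Rightarrow> 'a set set \<Rightarrow> 'b set \<Rightarrow> 'b set set \<Rightarrow> bool" where
  "is_Berge V E W H \<longleftrightarrow>
     (\<exists>i f. inj_on i V \<and> i ` V \<subseteq> W \<and> bij_betw f E H \<and>
            (\<forall>u v. {u, v} \<in> E \<longrightarrow> {i u, i v} \<subseteq> f {u, v}))"

definition Berge_free :: "'a set \<Rightarrow> 'a set set \<Rightarrow> 'b set \<Rightarrow> 'b set set \<Rightarrow> bool" where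
  "Berge_free V E W H \<longleftrightarrow> \<not> (\<exists>W' H'. subhypergraph W' H' W H \<and> is_Berge V E W' H')"

text \<open>Every finite hypergraph is isomorphic to one whose vertices are natural numbers.\<close>

definition shadow_sizes :: "'a set \<Rightarrow> 'a set set \<Rightarrow> nat \<Rightarrow> nat set" where
  "shadow_sizes V E n =
     {card (shadow W H) | (W :: nat set) H. three_graph W H \<and> card W = n \<and> Berge_free V E W H}"

lemma finite_shadow_sizes: "finite (shadow_sizes V E n)"
proof -
  have "card (shadow W H) \<le> 2 ^ n" if "finite W" "card W = n" for W :: "nat set" and H
  proof -
    have "shadow W H \<subseteq> Pow W" by (auto simp: shadow_def)
    then show ?thesis using card_mono[of "Pow W" "shadow W H"] that by (simp add: card_Pow)
  qed
  then have "shadow_sizes V E n \<subseteq> {..2 ^ n}"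
    by (auto simp: shadow_sizes_def uniform_hypergraph_def)
  then show ?thesis by (rule finite_subset) simp
qed

text \<open>On the natural numbers the supremum of a finite nonempty set is its maximum, and the
  supremum of the empty set is 0. The empty case arises only if the graph has no edges and
  at most \<open>n\<close> vertices, as no 3-graph on \<open>n\<close> vertices is then Berge-free.\<close>

definition ex_shadow3 :: "'a set \<Rightarrow> 'a set set \<Rightarrow> nat \<Rightarrow> nat" where
  "ex_shadow3 V E n = Sup (shadow_sizes V E n)"

lemma ex_shadow3_eq_Max:
  "shadow_sizes V E n \<noteq> {} \<Longrightarrow> ex_shadow3 V E n = Max (shadow_sizes V E n)"
  by (simp add: ex_shadow3_def Sup_nat_def)

definition pi_shadow3 :: "'a set \<Rightarrow> 'a set set \<Rightarrow> ereal" where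
  "pi_shadow3 V E = limsup (\<lambda>n. ereal (real (ex_shadow3 V E n) / real (n choose 2)))"

definition triangle_free :: "'a set set \<Rightarrow> bool" where
  "triangle_free E \<longleftrightarrow>
     \<not> (\<exists>u v w. u \<noteq> v \<and> v \<noteq> w \<and> u \<noteq> w \<and> {u, v} \<in> E \<and> {v, w} \<in> E \<and> {u, w} \<in> E)"

definition induced_edges :: "'a set set \<Rightarrow> 'a set \<Rightarrow> 'a set set" where
  "induced_edges E S = {e \<in> E. e \<subseteq> S}"

definition bipartition :: "'a set \<Rightarrow> 'a set set \<Rightarrow> 'a set \<Rightarrow> 'a set \<Rightarrow> bool" where
  "bipartition V E X Y \<longleftrightarrow>
     X \<union> Y = V \<and> X \<inter> Y = {} \<and> (\<forall>e\<in>E. \<exists>x\<in>X. \<exists>y\<in>Y. e = {x, y})"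

definition bipartite :: "'a set \<Rightarrow> 'a set set \<Rightarrow> bool" where
  "bipartite V E \<longleftrightarrow> (\<exists>X Y. bipartition V E X Y)"

definition matching :: "'a set set \<Rightarrow> bool" where
  "matching M \<longleftrightarrow> disjoint M"

end

theory Submission
  imports Defs "HOL-Analysis.Convex"
begin

text \<open>
  Necessity comes from two 3-graphs with quadratic shadow. In the edges \<open>{0, a, b}\<close> with \<open>(a, b)\<close>
  ranging over a biclique, deleting \<open>0\<close> leaves a bipartite shadow. In the edges \<open>{a, a', b}\<close>, with
  the pairs \<open>aa'\<close> disjoint, the shadow is a biclique plus a matching on one side, and a triangle
  \<open>a, a', b\<close> would have to use the edge \<open>{a, a', b}\<close> twice.

  For sufficiency, choose a dense set \<open>D\<close> of shadow pairs lying in distinct hyperedges. By counting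
  4-cycles, most \<open>(x, y) \<in> D\<close> are joined by a positive proportion of all possible paths of length 3
  in \<open>D\<close>. Classify these pairs by the third vertex \<open>z\<close> of their hyperedge.
  \<^item> If for some \<open>z\<close> they contain a large matching, then a bounded number of matching
    edges \<open>(x, y)\<close> share a positive proportion of the middle pairs of their 3-paths. This gives a
    blow-up of the 5-cycle at all vertices except \<open>z\<close>, and it contains every triangle-free graph
    that becomes bipartite after deleting a vertex.
  \<^item> Otherwise, for each \<open>z\<close>, a positive proportion of the pairs share an endpoint \<open>u z\<close>. Linearly
    many of these stars have linear size, so boundedly many of them have many common
    leaves \<open>b\<close>. The hyperedges \<open>{u z, z, b}\<close> then form the second 3-graph above.
\<close>

subsection \<open>Dense families and relations\<close>

text \<open>Double counting and pigeonhole. Points lying in fewer than \<open>t\<close> of the sets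
  account for at most half of the incidences, so the set \<open>B\<close> of points lying in at
  least \<open>t\<close> of them has proportion at least \<open>c / 2\<close>. The traces
  \<open>\<tau> w\<close> take at most \<open>2 ^ card I\<close> values, so some trace
  \<open>S\<close> is shared by a \<open>2 ^ card I\<close>-th part of \<open>B\<close>, and any
  \<open>t\<close>-subset of \<open>S\<close> serves as \<open>J\<close>.\<close>

lemma dense_sets_common_intersection:
  fixes F :: "'i \<Rightarrow> 'w set" and c :: real
  assumes fin: "finite \<Omega>" "finite I" and c: "c > 0"
    and t: "2 * real t \<le> c * card I" and ne: "\<Omega> \<noteq> {}" "I \<noteq> {}"
    and F: "\<And>i. i \<in> I \<Longrightarrow> F i \<subseteq> \<Omega>" "\<And>i. i \<in> I \<Longrightarrow> c * card \<Omega> \<le> card (F i)"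
  obtains J where "J \<subseteq> I" "card J = t" "c / 2 ^ Suc (card I) * card \<Omega> \<le> card {w \<in> \<Omega>. \<forall>j\<in>J. w \<in> F j}"
proof -
  define \<tau> where "\<tau> w = {i \<in> I. w \<in> F i}" for w
  define B where "B = {w \<in> \<Omega>. t \<le> card (\<tau> w)}"
  have finB: "finite B" using fin by (auto simp: B_def)
  have cardI: "card I > 0" using fin ne by (simp add: card_gt_0_iff)
  have \<tau>sub: "\<tau> ` X \<subseteq> Pow I" for X by (auto simp: \<tau>_def)
  have \<tau>I: "card (\<tau> w) \<le> card I" for w
    using fin by (auto simp: \<tau>_def intro: card_mono)
  have "(\<Sum>i\<in>I. card (F i)) = (\<Sum>i\<in>I. card {w \<in> \<Omega>. w \<in> F i})"
    using F(1) by (intro sum.cong refl arg_cong[where f = card]) auto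
  also have "\<dots> = (\<Sum>w\<in>\<Omega>. card (\<tau> w))"
    using sum_multicount_gen[of I \<Omega> "\<lambda>i w. w \<in> F i" "\<lambda>w. card (\<tau> w)"] fin by (simp add: \<tau>_def)
  also have "\<dots> \<le> (\<Sum>w\<in>\<Omega>. t + (if w \<in> B then card I else 0))"
    by (intro sum_mono) (use \<tau>I in \<open>auto simp: B_def intro: le_trans add_increasing\<close>)
  also have "\<dots> = card \<Omega> * t + card B * card I"
    using fin by (simp add: sum.distrib sum.If_cases B_def Int_def conj_commute)
  finally have "(\<Sum>i\<in>I. real (card (F i))) \<le> real (card \<Omega>) * t + card B * card I"
    by (metis of_nat_add of_nat_le_iff of_nat_mult of_nat_sum)
  moreover have "(\<Sum>i\<in>I. c * card \<Omega>) \<le> (\<Sum>i\<in>I. real (card (F i)))"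
    by (intro sum_mono F)
  ultimately have "c * card \<Omega> * card I \<le> real (card \<Omega>) * t + card B * card I"
    by (simp add: mult_ac)
  moreover have "real (card \<Omega>) * (2 * real t) \<le> real (card \<Omega>) * (c * card I)"
    by (intro mult_left_mono t) simp
  ultimately have "(c / 2 * card \<Omega>) * card I \<le> card B * card I" by (simp add: field_simps)
  then have B: "c / 2 * card \<Omega> \<le> card B" using cardI by simp
  have "\<exists>S\<in>Pow I. real (card B) \<le> 2 ^ card I * real (card {w \<in> B. \<tau> w = S})"
  proof (rule ccontr)
    assume "\<not> (\<exists>S\<in>Pow I. real (card B) \<le> 2 ^ card I * real (card {w \<in> B. \<tau> w = S}))"
    then have *: "2 ^ card I * real (card {w \<in> B. \<tau> w = S}) < card B" if "S \<in> Pow I" for S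
      using that by (metis linorder_not_le)
    have "card B = (\<Sum>S\<in>Pow I. card {w \<in> B. \<tau> w = S})"
      using sum_fun_comp[of B "Pow I" \<tau> "\<lambda>_. 1::nat"] fin finB \<tau>sub by simp
    then have "2 ^ card I * real (card B) = (\<Sum>S\<in>Pow I. 2 ^ card I * real (card {w \<in> B. \<tau> w = S}))"
      by (simp add: sum_distrib_left)
    also have "\<dots> < (\<Sum>S\<in>Pow I. real (card B))"
      by (rule sum_strict_mono[OF _ _ *]) (use fin in auto)
    also have "\<dots> = 2 ^ card I * real (card B)" using fin by (simp add: card_Pow)
    finally show False by simp
  qed
  then obtain S where S: "S \<subseteq> I" "real (card B) \<le> 2 ^ card I * card {w \<in> B. \<tau> w = S}" by auto
  have "card \<Omega> > 0" using fin ne by (simp add: card_gt_0_iff)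
  then have "card B > 0" using B c
    by (metis half_gt_zero less_le_trans mult_pos_pos of_nat_0_less_iff)
  then have "{w \<in> B. \<tau> w = S} \<noteq> {}" using S(2)
    by (metis card.empty mult_zero_right not_le of_nat_0 of_nat_0_less_iff)
  then have "t \<le> card S" by (auto simp: B_def)
  then obtain J where J: "J \<subseteq> S" "card J = t" using obtain_subset_with_card_n by metis
  have "c / 2 ^ Suc (card I) * card \<Omega> = c / 2 * card \<Omega> / 2 ^ card I" by simp
  also have "\<dots> \<le> card B / 2 ^ card I" by (intro divide_right_mono B) simp
  also have "\<dots> \<le> card {w \<in> B. \<tau> w = S}" using S by (simp add: field_simps)
  also have "\<dots> \<le> card {w \<in> \<Omega>. \<forall>j\<in>J. w \<in> F j}"
    using J fin by (intro of_nat_mono card_mono) (auto simp: B_def \<tau>_def)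
  finally show ?thesis using that J S by blast
qed

text \<open>Reverse Markov inequality: values below \<open>a / 2\<close> contribute at most half of
  the assumed lower bound on the sum, so the large values, each at most \<open>K\<close>, supply the
  other half.\<close>

lemma card_large_values:
  fixes f :: "'w \<Rightarrow> nat" and a :: real
  assumes "finite W" and le: "\<And>w. w \<in> W \<Longrightarrow> f w \<le> K" and a: "a * card W \<le> (\<Sum>w\<in>W. f w)"
  shows "a / 2 * card W \<le> K * card {w \<in> W. a / 2 \<le> f w}"
proof (cases "a \<ge> 0")
  case a0: True
  have "a * card W \<le> (\<Sum>w\<in>W. real (f w))" using a by simp
  also have "\<dots> \<le> (\<Sum>w\<in>W. a / 2 + (if a / 2 \<le> f w then real K else 0))"
    using le a0 by (intro sum_mono) (auto simp: add_increasing)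
  also have "\<dots> = a / 2 * card W + real K * card {w \<in> W. a / 2 \<le> f w}"
    using assms(1) by (simp add: sum.distrib sum.If_cases Int_def)
  finally show ?thesis by simp
next
  case False
  then have "a / 2 * card W \<le> 0" by (simp add: mult_nonpos_nonneg)
  also have "0 \<le> real K * card {w \<in> W. a / 2 \<le> f w}" by simp
  finally show ?thesis by simp
qed

section \<open>Counting 4-cycles and finding bicliques\<close>

text \<open>Write n for \<open>card W\<close>. Cauchy-Schwarz applied twice gives at least
  \<gamma>^4 n^4 quadruples x, y, p, q spanning a 4-cycle in the bipartite graph of
  \<open>S\<close>, degenerate ones with p = x or q = y included. They are spread over at most n^2
  edges (x, y), so some edge lies in \<gamma>^4 n^2 of them.\<close>

lemma exists_edge_in_many_4_cycles:
  fixes S :: "('w \<times> 'w) set" and \<gamma> :: real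
  assumes W: "finite W" "S \<subseteq> W \<times> W" and S: "S \<noteq> {}" "\<gamma> \<ge> 0" "\<gamma> * card W ^ 2 \<le> card S"
  shows "\<exists>(x, y)\<in>S. \<gamma> ^ 4 * card W ^ 2 \<le> card {(p, q) \<in> S. (x, q) \<in> S \<and> (p, y) \<in> S}"
proof -
  define \<chi> :: "'w \<Rightarrow> 'w \<Rightarrow> real" where "\<chi> x y = of_bool ((x, y) \<in> S)" for x y
  \<comment> \<open>\<open>k x p\<close> is the codegree of \<open>x\<close> and \<open>p\<close>;
    the sum of its squares over all pairs counts the 4-cycles.\<close>
  define k where "k x p = (\<Sum>y\<in>W. \<chi> x y * \<chi> p y)" for x p
  define C where "C x y = {(p, q) \<in> S. (x, q) \<in> S \<and> (p, y) \<in> S}" for x y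
  define n where "n = real (card W)"
  have finS: "finite S" using W finite_subset by blast
  have n0: "n > 0" using W S by (auto simp: n_def card_gt_0_iff)
  have "real (card S) = (\<Sum>e\<in>W \<times> W. of_bool (e \<in> S))"
    using W by (simp add: Int_absorb1)
  also have "\<dots> = (\<Sum>x\<in>W. \<Sum>y\<in>W. \<chi> x y)"
    by (simp add: sum.cartesian_product \<chi>_def)
  also have "\<dots> = (\<Sum>y\<in>W. \<Sum>x\<in>W. \<chi> x y)" by (rule sum.swap)
  \<comment> \<open>First Cauchy-Schwarz, over the right endpoint \<open>y\<close>. The second one,
    giving fact 2, runs over the pairs (x, p).\<close>
  finally have "real (card S) ^ 2 \<le> (\<Sum>y\<in>W. (\<Sum>x\<in>W. \<chi> x y) ^ 2) * n"
    unfolding n_def by (metis sum_squared_le_sum_of_squares W(1))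
  also have "(\<Sum>y\<in>W. (\<Sum>x\<in>W. \<chi> x y) ^ 2) = (\<Sum>y\<in>W. \<Sum>x\<in>W. \<Sum>p\<in>W. \<chi> x y * \<chi> p y)"
    by (simp add: power2_eq_square sum_product)
  also have "\<dots> = (\<Sum>x\<in>W. \<Sum>p\<in>W. k x p)"
    unfolding k_def by (rule trans[OF sum.swap], rule sum.cong[OF refl], rule sum.swap)
  also have "\<dots> = (\<Sum>(x,p)\<in>W \<times> W. k x p)" by (simp add: sum.cartesian_product)
  finally have 1: "real (card S) ^ 2 \<le> (\<Sum>(x,p)\<in>W \<times> W. k x p) * n" .
  have 2: "(\<Sum>(x,p)\<in>W \<times> W. k x p) ^ 2 \<le> (\<Sum>(x,p)\<in>W \<times> W. (k x p) ^ 2) * n ^ 2"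
    using sum_squared_le_sum_of_squares[of "\<lambda>(x,p). k x p" "W \<times> W"] W(1)
    by (simp add: n_def card_cartesian_product power2_eq_square case_prod_unfold)
  have "(\<gamma> * n ^ 2) ^ 4 \<le> real (card S) ^ 4"
    using S by (intro power_mono) (auto simp: n_def)
  also have "\<dots> = (real (card S) ^ 2) ^ 2" by simp
  also have "\<dots> \<le> ((\<Sum>(x,p)\<in>W \<times> W. k x p) * n) ^ 2"
    using 1 by (intro power_mono) auto
  also have "\<dots> = (\<Sum>(x,p)\<in>W \<times> W. k x p) ^ 2 * n ^ 2" by (simp add: power_mult_distrib)
  also have "\<dots> \<le> (\<Sum>(x,p)\<in>W \<times> W. (k x p) ^ 2) * n ^ 2 * n ^ 2"
    using 2 by (intro mult_right_mono) auto
  finally have "\<gamma> ^ 4 * n ^ 4 * n ^ 4 \<le> (\<Sum>(x,p)\<in>W \<times> W. (k x p) ^ 2) * n ^ 4"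
    by (simp add: power_mult_distrib mult.assoc flip: power_add power_mult)
  then have 3: "\<gamma> ^ 4 * n ^ 4 \<le> (\<Sum>(x,p)\<in>W \<times> W. (k x p) ^ 2)" using n0 by simp
  have "(\<Sum>(x,p)\<in>W \<times> W. (k x p) ^ 2) =
      (\<Sum>x\<in>W. \<Sum>p\<in>W. \<Sum>y\<in>W. \<Sum>q\<in>W. \<chi> x y * \<chi> p y * (\<chi> x q * \<chi> p q))"
    by (simp add: k_def power2_eq_square sum_product flip: sum.cartesian_product)
  \<comment> \<open>Exchanging \<open>p\<close> and \<open>y\<close> groups the 4-cycles by their
    edge (x, y).\<close>
  also have "\<dots> = (\<Sum>x\<in>W. \<Sum>y\<in>W. \<Sum>p\<in>W. \<Sum>q\<in>W. \<chi> x y * \<chi> p y * (\<chi> x q * \<chi> p q))"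
    by (rule sum.cong[OF refl], rule sum.swap)
  also have "\<dots> = (\<Sum>x\<in>W. \<Sum>y\<in>W. of_bool ((x, y) \<in> S) * real (card (C x y)))"
  proof (intro sum.cong refl)
    fix x y
    have "(\<Sum>p\<in>W. \<Sum>q\<in>W. \<chi> x y * \<chi> p y * (\<chi> x q * \<chi> p q)) =
        (\<Sum>(p,q)\<in>W \<times> W. of_bool ((x, y) \<in> S) * of_bool ((p, q) \<in> C x y))"
      unfolding sum.cartesian_product by (intro sum.cong) (auto simp: \<chi>_def C_def)
    also have "\<dots> = of_bool ((x, y) \<in> S) * (\<Sum>e\<in>W \<times> W. of_bool (e \<in> C x y))"
      by (simp add: case_prod_unfold sum_distrib_left)
    also have "(\<Sum>e\<in>W \<times> W. of_bool (e \<in> C x y)) = real (card (C x y))"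
    proof -
      have "C x y \<subseteq> W \<times> W" using W by (auto simp: C_def)
      then show ?thesis using W by (simp add: Int_absorb1)
    qed
    finally show "(\<Sum>p\<in>W. \<Sum>q\<in>W. \<chi> x y * \<chi> p y * (\<chi> x q * \<chi> p q)) = of_bool ((x, y) \<in> S) * real (card (C x y))" .
  qed
  also have "\<dots> = (\<Sum>(x,y)\<in>S. real (card (C x y)))"
    unfolding sum.cartesian_product using W
    by (intro sum.mono_neutral_cong_right) auto
  finally have 4: "\<gamma> ^ 4 * n ^ 4 \<le> (\<Sum>(x,y)\<in>S. real (card (C x y)))" using 3 by simp
  show ?thesis
  proof (rule ccontr)
    assume "\<not> ?thesis"
    then have lt: "\<And>e. e \<in> S \<Longrightarrow> (case e of (x, y) \<Rightarrow> real (card (C x y))) < \<gamma> ^ 4 * n ^ 2"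
      by (auto simp: C_def n_def not_le)
    have "(\<Sum>(x,y)\<in>S. real (card (C x y))) < (\<Sum>e\<in>S. \<gamma> ^ 4 * n ^ 2)"
      using finS S lt by (intro sum_strict_mono) auto
    also have "\<dots> = card S * (\<gamma> ^ 4 * n ^ 2)" by simp
    also have "\<dots> \<le> n ^ 2 * (\<gamma> ^ 4 * n ^ 2)"
    proof (intro mult_right_mono)
      have "card S \<le> card (W \<times> W)" using W by (intro card_mono) auto
      then show "real (card S) \<le> n ^ 2"
        by (simp add: n_def card_cartesian_product power2_eq_square flip: of_nat_mult)
    qed auto
    finally show False using 4 by (simp add: power2_eq_square power4_eq_xxxx algebra_simps)
  qed
qed

text \<open>The Kovari-Sos-Turan argument for ordered pairs: linearly many rows have linear size,
  and among a bounded number \<open>m\<close> of them some \<open>t\<close> rows share linearly many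
  columns.\<close>

lemma dense_relation_contains_biclique:
  fixes c :: real
  assumes c: "c > 0"
  shows "\<exists>N. \<forall>(W :: 'w set) F. finite W \<longrightarrow> N \<le> card W \<longrightarrow> F \<subseteq> W \<times> W \<longrightarrow> c * card W ^ 2 \<le> card F \<longrightarrow>
    (\<exists>P Q. P \<subseteq> W \<and> Q \<subseteq> W \<and> card P = t \<and> card Q = t \<and> P \<times> Q \<subseteq> F)"
proof -
  define m where "m = Suc (nat \<lceil>4 * real t / c\<rceil>)"
  have m: "2 * real t \<le> c / 2 * m" "m > 0"
  proof -
    have "4 * real t / c \<le> m" unfolding m_def by linarith
    then show "2 * real t \<le> c / 2 * m" using c by (simp add: field_simps)
  qed (simp add: m_def)
  \<comment> \<open>The first summand provides \<open>m\<close> rows of size at least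
    \<open>c / 2 * card W\<close>, the second makes the common part of the selected rows have at
    least \<open>t\<close> elements.\<close>
  define N where "N = Suc (nat \<lceil>2 * real m / c\<rceil> + nat \<lceil>t / (c / 2 / 2 ^ Suc m)\<rceil>)"
  show ?thesis
  proof (intro exI[of _ N] allI impI)
    fix W :: "'w set" and F
    assume W: "finite W" "N \<le> card W" "F \<subseteq> W \<times> W" "c * card W ^ 2 \<le> card F"
    have n0: "real (card W) > 0" using W by (simp add: N_def)
    have n1: "2 * real m / c \<le> card W" and n2: "t / (c / 2 / 2 ^ Suc m) \<le> card W"
      using W(2) unfolding N_def by linarith+
    define Z where "Z = {p \<in> W. (c * card W) / 2 \<le> card (F `` {p})}"
    have finF: "finite F" using W finite_subset by blast
    have row: "F `` {p} \<subseteq> W" for p using W by auto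
    have "card F = (\<Sum>p\<in>W. card (F `` {p}))"
    proof -
      have "F = Sigma W (\<lambda>p. F `` {p})" using W by auto
      then show ?thesis using W row by (metis card_SigmaI finite_subset)
    qed
    then have "(c * card W) * card W \<le> (\<Sum>p\<in>W. card (F `` {p}))"
      using W by (simp add: power2_eq_square mult.assoc)
    from card_large_values[OF W(1) _ this, of "card W"]
    have "c * card W / 2 * card W \<le> real (card W) * card Z"
      using W row by (auto simp: Z_def intro: card_mono)
    then have "c / 2 * card W \<le> card Z" using n0 by simp
    moreover have "real m \<le> c / 2 * card W" using n1 c by (simp add: field_simps)
    ultimately have "m \<le> card Z" by linarith
    then obtain I where I: "I \<subseteq> Z" "card I = m" "finite I"
      using obtain_subset_with_card_n by metis
    have IF: "c / 2 * card W \<le> card (F `` {p})" if "p \<in> I" for p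
      using that I by (auto simp: Z_def)
    obtain P where P: "P \<subseteq> I" "card P = t"
      "c / 2 / 2 ^ Suc (card I) * card W \<le> card {w \<in> W. \<forall>p\<in>P. w \<in> F `` {p}}"
      by (rule dense_sets_common_intersection[OF W(1) I(3), of "c / 2" t "\<lambda>p. F `` {p}"])
        (use c m I n0 row IF in \<open>auto simp del: power_Suc\<close>)
    have "real t \<le> c / 2 / 2 ^ Suc m * card W" using n2 c by (simp add: field_simps)
    then have "t \<le> card {w \<in> W. \<forall>p\<in>P. w \<in> F `` {p}}" using P(3)[unfolded I(2)] by linarith
    then obtain Q where Q: "Q \<subseteq> {w \<in> W. \<forall>p\<in>P. w \<in> F `` {p}}" "card Q = t"
      by (rule obtain_subset_with_card_n) blast
    have "P \<subseteq> W" "Q \<subseteq> W" using P(1) I(1) Q(1) by (auto simp: Z_def)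
    moreover have "P \<times> Q \<subseteq> F" using Q(1) by blast
    ultimately show "\<exists>P Q. P \<subseteq> W \<and> Q \<subseteq> W \<and> card P = t \<and> card Q = t \<and> P \<times> Q \<subseteq> F"
      using P(2) Q(2) by blast
  qed
qed

text \<open>The middle pairs of the paths x, q, p, y form, for each (x, y) in \<open>M\<close>, a
  dense subset of the square of \<open>W\<close>. Among sufficiently many such subsets some share a
  positive proportion of all pairs, and this common part contains a biclique by the preceding
  lemma.\<close>

lemma matched_edges_extend_to_biclique:
  fixes c :: real
  assumes c: "c > 0" and t: "t > 0"
  shows "\<exists>R N. \<forall>(W :: 'w set) D M. finite W \<longrightarrow> N \<le> card W \<longrightarrow> D \<subseteq> W \<times> W \<longrightarrow> M \<subseteq> D \<longrightarrow> card M = R \<longrightarrow>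
      (\<forall>(x, y)\<in>M. c * card W ^ 2 \<le> card {(p, q) \<in> D. (x, q) \<in> D \<and> (p, y) \<in> D}) \<longrightarrow>
    (\<exists>J P Q. J \<subseteq> M \<and> card J = s \<and> P \<subseteq> W \<and> Q \<subseteq> W \<and> card P = t \<and> card Q = t \<and>
      P \<times> Q \<subseteq> D \<and> (\<forall>(x, y)\<in>J. {x} \<times> Q \<subseteq> D \<and> P \<times> {y} \<subseteq> D))"
proof -
  \<comment> \<open>Asking for \<open>Suc s\<close> members keeps \<open>J'\<close> nonempty even if
    s = 0, so that the inclusion of the biclique in \<open>D\<close> can be read off one of
    them.\<close>
  define R where "R = Suc (nat \<lceil>2 * real (Suc s) / c\<rceil>)"
  have R: "2 * real (Suc s) \<le> c * R"
  proof -
    have "2 * real (Suc s) / c \<le> R" unfolding R_def by linarith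
    then show ?thesis using c by (simp add: field_simps)
  qed
  have c': "c / 2 ^ Suc R > 0" using c by simp
  obtain N where N: "\<And>(W :: 'w set) F. finite W \<Longrightarrow> N \<le> card W \<Longrightarrow> F \<subseteq> W \<times> W \<Longrightarrow>
      c / 2 ^ Suc R * card W ^ 2 \<le> card F \<Longrightarrow>
      \<exists>P Q. P \<subseteq> W \<and> Q \<subseteq> W \<and> card P = t \<and> card Q = t \<and> P \<times> Q \<subseteq> F"
    using dense_relation_contains_biclique[OF c', where t = t] by metis
  show ?thesis
  proof (rule exI[of _ R], rule exI[of _ "Suc N"], intro allI impI)
    fix W :: "'w set" and D M
    assume W: "finite W" "Suc N \<le> card W" and D: "D \<subseteq> W \<times> W" and M: "M \<subseteq> D" "card M = R"
      and dense: "\<forall>(x, y)\<in>M. c * card W ^ 2 \<le> card {(p, q) \<in> D. (x, q) \<in> D \<and> (p, y) \<in> D}"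
    define F where "F e = {(p, q) \<in> D. (fst e, q) \<in> D \<and> (p, snd e) \<in> D}" for e
    have fin: "finite (W \<times> W)" "finite M" "W \<times> W \<noteq> {}" "M \<noteq> {}"
      using W M card_ge_0_finite[of M] by (auto simp: R_def)
    have card_WW: "card (W \<times> W) = card W ^ 2"
      by (simp add: card_cartesian_product power2_eq_square)
    have F1: "F e \<subseteq> W \<times> W" for e
      using D by (auto simp: F_def)
    have F2: "c * card (W \<times> W) \<le> card (F e)" if "e \<in> M" for e
      using dense that by (auto simp: F_def card_WW)
    have le: "2 * real (Suc s) \<le> c * card M" using R M(2) by simp
    obtain J' where J': "J' \<subseteq> M" "card J' = Suc s"
      "c / 2 ^ Suc (card M) * card (W \<times> W) \<le> card {w \<in> W \<times> W. \<forall>j\<in>J'. w \<in> F j}"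
      by (rule dense_sets_common_intersection[OF fin(1,2) c le fin(3,4) F1 F2])
    then have "c / 2 ^ Suc R * card W ^ 2 \<le> card {w \<in> W \<times> W. \<forall>j\<in>J'. w \<in> F j}"
      using M(2) card_WW by metis
    from N[OF W(1) _ _ this] W(2) obtain P Q where
      PQ: "P \<subseteq> W" "Q \<subseteq> W" "card P = t" "card Q = t" "P \<times> Q \<subseteq> {w \<in> W \<times> W. \<forall>j\<in>J'. w \<in> F j}"
      by auto
    have "J' \<noteq> {}" using J'(2) by auto
    then obtain j where j: "j \<in> J'" by blast
    \<comment> \<open>The sets \<open>F e\<close> constrain only whole pairs (p, q). Reading off the
      condition on \<open>q\<close> alone requires some \<open>p\<close>, and conversely.\<close>
    have "P \<noteq> {}" "Q \<noteq> {}" using PQ t by auto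
    then obtain p0 q0 where 0: "p0 \<in> P" "q0 \<in> Q" by blast
    have FD: "(p, q) \<in> D \<and> (fst e, q) \<in> D \<and> (p, snd e) \<in> D" if "p \<in> P" "q \<in> Q" "e \<in> J'" for p q e
      using PQ(5) that by (auto simp: F_def)
    have "{x} \<times> Q \<subseteq> D \<and> P \<times> {y} \<subseteq> D" if "(x, y) \<in> J'" for x y
      using FD[OF _ _ that] 0 by auto
    moreover obtain J where J: "J \<subseteq> J'" "card J = s"
      using J'(2) obtain_subset_with_card_n[of s J'] by auto
    ultimately have "\<forall>(x, y)\<in>J. {x} \<times> Q \<subseteq> D \<and> P \<times> {y} \<subseteq> D" by blast
    moreover have "P \<times> Q \<subseteq> D" "J \<subseteq> M" using FD[OF _ _ j] J(1) J'(1) by auto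
    ultimately show "\<exists>J P Q. J \<subseteq> M \<and> card J = s \<and> P \<subseteq> W \<and> Q \<subseteq> W \<and> card P = t \<and> card Q = t \<and>
      P \<times> Q \<subseteq> D \<and> (\<forall>(x, y)\<in>J. {x} \<times> Q \<subseteq> D \<and> P \<times> {y} \<subseteq> D)"
      using PQ(1-4) J(2) by (intro exI conjI)
  qed
qed

section \<open>Separated stars with common leaves\<close>

text \<open>Greedy choice. After m choices the set \<open>T\<close> of used vertices, consisting of
  the chosen elements and their images, has at most 2 m elements. A further z is blocked only if z
  or \<open>u z\<close> lies in \<open>T\<close>, which excludes at most 2 m + 2 m K
  elements.\<close>

lemma exists_separated_subset:
  assumes "finite Z" and u: "\<And>z. z \<in> Z \<Longrightarrow> u z \<noteq> z" and K: "\<And>w. card {z \<in> Z. u z = w} \<le> K"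
    and m: "m * (2 + 2 * K) < card Z"
  shows "\<exists>S\<subseteq>Z. card S = m \<and> inj_on u S \<and> u ` S \<inter> S = {}"
  using m
proof (induction m)
  case 0
  then show ?case by (intro exI[of _ "{}"]) auto
next
  case (Suc m)
  then obtain S where S: "S \<subseteq> Z" "card S = m" "inj_on u S" "u ` S \<inter> S = {}" by auto
  define T where "T = S \<union> u ` S"
  have finS: "finite S" using S assms(1) finite_subset by blast
  then have finT: "finite T" by (simp add: T_def)
  have cT: "card T \<le> 2 * m"
    using card_Un_le[of S "u ` S"] card_image_le[OF finS, of u] S(2) unfolding T_def by linarith
  define X where "X = T \<union> (\<Union>w\<in>T. {z \<in> Z. u z = w})"
  have finX: "finite X" using finT assms(1) by (auto simp: X_def)
  have "card (\<Union>w\<in>T. {z \<in> Z. u z = w}) \<le> (\<Sum>w\<in>T. card {z \<in> Z. u z = w})"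
    by (rule card_UN_le[OF finT])
  also have "\<dots> \<le> card T * K" using sum_bounded_above[of T _ K] K by auto
  finally have "card X \<le> card T + card T * K"
    unfolding X_def using card_Un_le[of T "\<Union>w\<in>T. {z \<in> Z. u z = w}"] by linarith
  also have "\<dots> \<le> 2 * m + 2 * m * K" using cT by (intro add_mono mult_mono) auto
  also have "\<dots> < card Z" using Suc.prems by (simp add: algebra_simps)
  finally obtain z where z: "z \<in> Z" "z \<notin> X"
    using card_mono[OF finX, of Z] by (meson linorder_not_less subsetI)
  then have "z \<notin> S" "z \<notin> u ` S" "u z \<notin> S" "u z \<notin> u ` S" by (auto simp: X_def T_def)
  with z S u[OF z(1)] finS show ?case
    by (intro exI[of _ "insert z S"]) auto
qed

text \<open>Both injectivity of \<open>u\<close> and disjointness of centres from their indices pass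
  to subsets. Hence a bounded number of separated stars is chosen first, and those with many common
  leaves are selected from among them.\<close>

lemma many_large_stars_yield_common_leaves:
  fixes \<beta> :: real
  assumes \<beta>: "\<beta> > 0"
  shows "\<exists>N. \<forall>(W :: 'w set) Z u A. finite W \<longrightarrow> N \<le> card W \<longrightarrow> Z \<subseteq> W \<longrightarrow> \<beta> * card W \<le> card Z \<longrightarrow>
     (\<forall>z\<in>Z. u z \<noteq> z \<and> A z \<subseteq> W \<and> \<beta> * card W \<le> card (A z)) \<longrightarrow> (\<forall>w. card {z \<in> Z. u z = w} \<le> K) \<longrightarrow>
    (\<exists>J B. J \<subseteq> Z \<and> card J = t \<and> inj_on u J \<and> u ` J \<inter> J = {} \<and> card B = t \<and> (\<forall>z\<in>J. B \<subseteq> A z))"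
proof -
  define m where "m = Suc (nat \<lceil>2 * real (Suc t) / \<beta>\<rceil>)"
  have m: "2 * real (Suc t) \<le> \<beta> * m"
  proof -
    have "2 * real (Suc t) / \<beta> \<le> m" unfolding m_def by linarith
    then show ?thesis using \<beta> by (simp add: field_simps)
  qed
  \<comment> \<open>The first summand makes \<open>Z\<close> large enough for the greedy choice of
    \<open>m\<close> elements, the second makes the common leaf set have at least \<open>t\<close>
    elements.\<close>
  define N where "N = Suc (nat \<lceil>Suc (m * (2 + 2 * K)) / \<beta>\<rceil> + nat \<lceil>t / (\<beta> / 2 ^ Suc m)\<rceil>)"
  show ?thesis
  proof (intro exI[of _ N] allI impI)
    fix W Z :: "'w set" and u :: "'w \<Rightarrow> 'w" and A
    assume W: "finite W" "N \<le> card W" and Z: "Z \<subseteq> W" "\<beta> * card W \<le> card Z"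
      and uA: "\<forall>z\<in>Z. u z \<noteq> z \<and> A z \<subseteq> W \<and> \<beta> * card W \<le> card (A z)"
      and K: "\<forall>w. card {z \<in> Z. u z = w} \<le> K"
    have n: "Suc (m * (2 + 2 * K)) / \<beta> \<le> card W" "t / (\<beta> / 2 ^ Suc m) \<le> card W" "W \<noteq> {}"
      using W(2) unfolding N_def by (linarith, linarith, auto)
    have "real (Suc (m * (2 + 2 * K))) \<le> \<beta> * card W" using n(1) \<beta> by (simp add: field_simps)
    then have "m * (2 + 2 * K) < card Z" using Z(2) by linarith
    then obtain S where S: "S \<subseteq> Z" "card S = m" "inj_on u S" "u ` S \<inter> S = {}"
      using exists_separated_subset[of Z u K m] uA K Z(1) W(1) finite_subset by metis
    have finS: "finite S" "S \<noteq> {}" using S(2) card_ge_0_finite[of S] by (auto simp: m_def)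
    have AS: "\<And>z. z \<in> S \<Longrightarrow> A z \<subseteq> W" "\<And>z. z \<in> S \<Longrightarrow> \<beta> * card W \<le> card (A z)"
      using uA S(1) by blast+
    have le: "2 * real (Suc t) \<le> \<beta> * card S" using m S(2) by simp
    obtain J' where J': "J' \<subseteq> S" "card J' = Suc t"
      "\<beta> / 2 ^ Suc (card S) * card W \<le> card {w \<in> W. \<forall>j\<in>J'. w \<in> A j}"
      by (rule dense_sets_common_intersection[OF W(1) finS(1) \<beta> le n(3) finS(2) AS])
    have "real t \<le> \<beta> / 2 ^ Suc m * card W" using n(2) \<beta> by (simp add: field_simps)
    then have "t \<le> card {w \<in> W. \<forall>j\<in>J'. w \<in> A j}" using J'(3)[unfolded S(2)] by linarith
    then obtain B where B: "B \<subseteq> {w \<in> W. \<forall>j\<in>J'. w \<in> A j}" "card B = t"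
      by (rule obtain_subset_with_card_n) blast
    obtain J where J: "J \<subseteq> J'" "card J = t" using J'(2) obtain_subset_with_card_n[of t J'] by auto
    have "J \<subseteq> S" using J J' by auto
    then have "J \<subseteq> Z" "inj_on u J" "u ` J \<inter> J = {}" using S by (auto intro: inj_on_subset)
    moreover have "\<forall>z\<in>J. B \<subseteq> A z" using B(1) J(1) by blast
    ultimately show "\<exists>J B. J \<subseteq> Z \<and> card J = t \<and> inj_on u J \<and> u ` J \<inter> J = {} \<and> card B = t \<and>
      (\<forall>z\<in>J. B \<subseteq> A z)"
      using J(2) B(2) by blast
  qed
qed

subsection \<open>Embeddings\<close>

text \<open>The Berge copy is the image of \<open>E\<close> under \<open>f\<close>, kept on the
  whole vertex set \<open>W\<close>. This lets later embeddings be given by two injections, without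
  naming a subhypergraph.\<close>

lemma not_Berge_free_if_edge_injection:
  assumes "uniform_hypergraph r W H" "inj_on i V" "i ` V \<subseteq> W" "inj_on f E" "f ` E \<subseteq> H"
    and "\<And>u v. {u, v} \<in> E \<Longrightarrow> {i u, i v} \<subseteq> f {u, v}"
  shows "\<not> Berge_free V E W H"
proof -
  have "subhypergraph W (f ` E) W H"
    using assms(1,5) by (auto simp: subhypergraph_def uniform_hypergraph_def)
  moreover have "is_Berge V E W (f ` E)"
    unfolding is_Berge_def using assms by (intro exI[of _ i] exI[of _ f]) (auto simp: bij_betw_def)
  ultimately show ?thesis unfolding Berge_free_def by blast
qed

lemma triangle_freeD:
  assumes "triangle_free E" "{u, v} \<in> E" "{v, w} \<in> E" "{u, w} \<in> E" "u \<noteq> v" "v \<noteq> w" "u \<noteq> w"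
  shows False
proof -
  have "\<exists>u v w. u \<noteq> v \<and> v \<noteq> w \<and> u \<noteq> w \<and> {u, v} \<in> E \<and> {v, w} \<in> E \<and> {u, w} \<in> E"
    using assms(2-) by (intro exI conjI)
  then show False using assms(1) by (simp only: triangle_free_def not_True_eq_False)
qed

text \<open>The vertex \<open>v\<close> goes to \<open>z\<close>. Its neighbours go to
  \<open>x\<close> or \<open>y\<close> and all other vertices to \<open>p\<close> or
  \<open>q\<close>, according to their side of the bipartition. Since \<open>E\<close> is
  triangle-free, an edge of the rest never joins two neighbours of \<open>v\<close>, so only the
  pairs of types (x, q), (p, q) and (p, y) are needed. These types together with z-x and z-y form a
  5-cycle. Injectivity of \<open>g\<close> turns distinct pairs into distinct hyperedges.\<close>

lemma Berge_copy_with_apex: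
  assumes G: "simple_graph V E" "triangle_free E" "v \<in> V"
    "bipartition (V - {v}) (induced_edges E (V - {v})) P Q"
    and H: "three_graph W H" and D: "D \<subseteq> W \<times> W" "inj_on g D"
      "\<And>x y. (x, y) \<in> D \<Longrightarrow> g (x, y) \<in> H \<and> {x, y} \<subseteq> g (x, y)"
    and xy: "\<And>a. a \<in> V \<Longrightarrow> (x a, y a) \<in> D \<and> z \<in> g (x a, y a)" "z \<in> W"
    and pq: "\<And>a b. a \<in> V \<Longrightarrow> b \<in> V \<Longrightarrow> (x a, q b) \<in> D \<and> (p a, q b) \<in> D \<and> (p a, y b) \<in> D"
    and inj: "inj_on x V" "inj_on y V" "inj_on p V" "inj_on q V"
    and disj: "x ` V \<inter> y ` V = {}" "x ` V \<inter> p ` V = {}" "x ` V \<inter> q ` V = {}" "y ` V \<inter> p ` V = {}"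
      "y ` V \<inter> q ` V = {}" "p ` V \<inter> q ` V = {}" "z \<notin> x ` V \<union> y ` V \<union> p ` V \<union> q ` V"
  shows "\<not> Berge_free V E W H"
proof -
  define i where "i a = (if a = v then z else if a \<in> P then (if {v, a} \<in> E then x a else p a)
      else (if {v, a} \<in> E then y a else q a))" for a
  have PQ: "P \<union> Q = V - {v}" "P \<inter> Q = {}"
    and PQE: "\<And>e. e \<in> E \<Longrightarrow> e \<subseteq> V - {v} \<Longrightarrow> \<exists>a\<in>P. \<exists>b\<in>Q. e = {a, b}"
    using G(4) by (auto simp: bipartition_def induced_edges_def)
  have E2: "e \<subseteq> V" "card e = 2" if "e \<in> E" for e
    using G(1) that by (auto simp: uniform_hypergraph_def)
  have inV: "x a \<in> x ` V" "y a \<in> y ` V" "p a \<in> p ` V" "q a \<in> q ` V" if "a \<in> V" for a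
    using that by auto
  have inW: "x a \<in> W" "y a \<in> W" "p a \<in> W" "q a \<in> W" if "a \<in> V" for a
    using xy(1)[OF that] pq[OF that that] D(1) by auto
  have inj_i: "inj_on i V"
  proof (rule inj_onI)
    fix a b assume ab: "a \<in> V" "b \<in> V" "i a = i b"
    then show "a = b"
      using inV[OF ab(1)] inV[OF ab(2)] disj inj_onD[OF inj(1), of a b] inj_onD[OF inj(2), of a b]
        inj_onD[OF inj(3), of a b] inj_onD[OF inj(4), of a b]
      unfolding i_def disjoint_iff by (smt (verit) UnI1 UnI2)
  qed
  have iW: "i ` V \<subseteq> W" using inW xy(2) by (auto simp: i_def)
  have iD: "(i a, i b) \<in> D" if "a \<in> P" "b \<in> Q" "{a, b} \<in> E" for a b
  proof -
    have ab: "a \<in> V" "b \<in> V" "a \<noteq> v" "b \<noteq> v" "b \<notin> P" "a \<noteq> b" using that PQ by auto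
    have "\<not> ({v, a} \<in> E \<and> {v, b} \<in> E)"
      using triangle_freeD[OF G(2) _ that(3)] ab by metis
    then show ?thesis using pq[of a b] ab that unfolding i_def by auto
  qed
  \<comment> \<open>An edge \<open>{v, a}\<close> gets the hyperedge of \<open>(x a, y a)\<close>, which contains \<open>z\<close>. That pair is never
    the image of an edge of \<open>G - v\<close>, as only one of \<open>x a\<close>, \<open>y a\<close> is in the image of the embedding.\<close>
  define R where "R e d \<longleftrightarrow> (\<exists>a\<in>V. a \<noteq> v \<and> e = {v, a} \<and> d = (x a, y a)) \<or>
      (\<exists>a\<in>P. \<exists>b\<in>Q. e = {a, b} \<and> d = (i a, i b))" for e d
  have "\<exists>d. R e d" if e: "e \<in> E" for e
  proof (cases "v \<in> e")
    case True
    then obtain a where "e = {v, a}" "a \<noteq> v" using E2[OF e] by (auto simp: card_2_iff doubleton_eq_iff)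
    then show ?thesis using E2[OF e] unfolding R_def by blast
  next
    case False
    then show ?thesis using PQE[OF e] E2[OF e] unfolding R_def by blast
  qed
  then obtain d where d: "\<And>e. e \<in> E \<Longrightarrow> R e (d e)" by metis
  have dD: "d e \<in> D" if "e \<in> E" for e
    using d[OF that] that xy(1) iD unfolding R_def by auto
  have mixed: False if "a \<in> V" "b \<in> P" "c \<in> Q" "(x a, y a) = (i b, i c)" for a b c
  proof -
    have bc: "b \<in> V" "c \<in> V" "b \<noteq> v" "c \<noteq> v" "c \<notin> P" "b \<noteq> c" using that PQ by auto
    have "x a = x b" using that bc inV[OF \<open>a \<in> V\<close>] inV[OF bc(1)] disj
      by (auto simp: i_def split: if_splits)
    moreover have "y a = y c" using that bc inV[OF \<open>a \<in> V\<close>] inV[OF bc(2)] disj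
      by (auto simp: i_def split: if_splits)
    ultimately show False using inj that(1) bc by (metis inj_onD)
  qed
  have "inj_on d E"
  proof (rule inj_onI)
    fix e e' assume e: "e \<in> E" "e' \<in> E" "d e = d e'"
    have ii: "(i a, i b) = (i a', i b') \<Longrightarrow> a = a' \<and> b = b'"
      if "a \<in> P" "b \<in> Q" "a' \<in> P" "b' \<in> Q" for a b a' b'
      using that PQ(1) inj_onD[OF inj_i, of a a'] inj_onD[OF inj_i, of b b'] by blast
    show "e = e'" using d[OF e(1)] d[OF e(2)] unfolding R_def e(3)
    proof (elim disjE bexE conjE, goal_cases)
      case (1 a a')
      then show ?case using inj(1) by (auto dest: inj_onD)
    next
      case (2 a a' b')
      then show ?case using mixed[of a a' b'] by auto
    next
      case (3 a a' b)
      then show ?case using mixed[of a' a b] by auto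
    next
      case (4 a a' b b')
      then show ?case using ii[of a b a' b'] by auto
    qed
  qed
  then have "inj_on (g \<circ> d) E" using dD by (auto intro!: comp_inj_on inj_on_subset[OF D(2)])
  moreover have "(g \<circ> d) ` E \<subseteq> H"
  proof
    fix h assume "h \<in> (g \<circ> d) ` E"
    then obtain e where "e \<in> E" "h = g (d e)" by auto
    then show "h \<in> H" using dD[of e] D(3)[of "fst (d e)" "snd (d e)"] by simp
  qed
  moreover have "{i a, i b} \<subseteq> (g \<circ> d) {a, b}" if e: "{a, b} \<in> E" for a b
    using d[OF e] unfolding R_def
  proof (elim disjE bexE conjE)
    fix c assume c: "c \<in> V" "c \<noteq> v" "{a, b} = {v, c}" "d {a, b} = (x c, y c)"
    have "i v = z" "i c = x c \<or> i c = y c" using c e PQ by (auto simp: i_def)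
    then have "{i v, i c} \<subseteq> g (d {a, b})" using xy(1)[OF c(1)] D(3) c(4) by auto
    moreover have "{i a, i b} = {i v, i c}" using c(3) by (auto simp: doubleton_eq_iff)
    ultimately show ?thesis by simp
  next
    fix c c' assume c: "c \<in> P" "c' \<in> Q" "{a, b} = {c, c'}" "d {a, b} = (i c, i c')"
    then have "{i c, i c'} \<subseteq> g (d {a, b})" using D(3) iD[of c c'] e by auto
    moreover have "{i a, i b} = {i c, i c'}" using c(3) by (auto simp: doubleton_eq_iff)
    ultimately show ?thesis by simp
  qed
  ultimately show ?thesis by (rule not_Berge_free_if_edge_injection[OF H inj_i iW])
qed

text \<open>The two ends of a matching edge go to the two vertices \<open>x r\<close>,
  \<open>z r\<close> of one doubled point, where r is the representative of the edge. Unmatched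
  vertices of \<open>U1\<close> go to their own \<open>x\<close>, and vertices of \<open>U2\<close>
  go to tips. Two crossing edges compete for a hyperedge only if they meet in \<open>U2\<close> and
  their other ends are matched, which would be a triangle.\<close>

lemma Berge_copy_in_doubled_biclique:
  assumes G: "simple_graph V E" "triangle_free E" "F \<subseteq> E" "bipartition V F U1 U2" "matching (E - F)"
    "\<forall>e\<in>E - F. e \<subseteq> U1"
    and H: "three_graph W H" and T: "\<And>a b. a \<in> V \<Longrightarrow> b \<in> V \<Longrightarrow> {x a, z a, y b} \<in> H"
    and inj: "inj_on x V" "inj_on y V" "inj_on z V"
    and disj: "x ` V \<inter> y ` V = {}" "x ` V \<inter> z ` V = {}" "y ` V \<inter> z ` V = {}"
  shows "\<not> Berge_free V E W H"
proof -
  define M where "M = E - F"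
  \<comment> \<open>\<open>K a\<close> is the matching edge at \<open>a\<close>, or the singleton of
    \<open>a\<close> if there is none. The choice in \<open>\<rho>\<close> depends on
    \<open>a\<close> only through \<open>K a\<close>, so both ends of a matching edge get the same
    representative.\<close>
  define K where "K a = insert a (\<Union>{e \<in> M. a \<in> e})" for a
  define \<rho> where "\<rho> a = (SOME b. b \<in> K a)" for a
  define i where "i a = (if a \<in> U2 then y a else if \<rho> a = a then x a else z (\<rho> a))" for a
  have U: "U1 \<union> U2 = V" "U1 \<inter> U2 = {}" and UF: "\<And>e. e \<in> F \<Longrightarrow> \<exists>a\<in>U1. \<exists>b\<in>U2. e = {a, b}"
    using G(4) by (auto simp: bipartition_def)
  have M: "e \<subseteq> U1" "card e = 2" if "e \<in> M" for e
    using G(1,6) that by (auto simp: uniform_hypergraph_def M_def)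
  have Meq: "e = e'" if "e \<in> M" "e' \<in> M" "a \<in> e" "a \<in> e'" for e e' a
    using G(5) that unfolding matching_def M_def disjoint_def by blast
  have KM: "K a = e" if "e \<in> M" "a \<in> e" for a e
    using that Meq unfolding K_def by blast
  have K0: "K a = {a}" if "\<And>e. e \<in> M \<Longrightarrow> a \<notin> e" for a
    using that by (auto simp: K_def)
  have \<rho>K: "\<rho> a \<in> K a" for a unfolding \<rho>_def by (rule someI[of _ a]) (simp add: K_def)
  have \<rho>U: "\<rho> a \<in> U1" if "a \<in> U1" for a
    using \<rho>K[of a] that M by (auto simp: K_def)
  have \<rho>eq: "a = b \<or> {a, b} \<in> M" if "\<rho> a = \<rho> b" for a b
  proof (cases "\<exists>e\<in>M. \<rho> a \<in> e")
    case True
    then obtain e where e: "e \<in> M" "\<rho> a \<in> e" by blast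
    have "a \<in> e" "b \<in> e" using \<rho>K[of a] \<rho>K[of b] e that Meq unfolding K_def by auto
    then show ?thesis using e(1) M(2)[OF e(1)] by (auto simp: card_2_iff insert_commute)
  next
    case False
    then have "a = \<rho> a" "b = \<rho> a" using \<rho>K[of a] \<rho>K[of b] that unfolding K_def by auto
    then show ?thesis by simp
  qed
  have \<rho>M: "\<rho> a = \<rho> b" if "{a, b} \<in> M" for a b
    using KM[OF that, of a] KM[OF that, of b] by (simp add: \<rho>_def)
  have inV: "x a \<in> x ` V" "y a \<in> y ` V" "z a \<in> z ` V" if "a \<in> V" for a
    using that by auto
  have ne: "x a \<noteq> z b \<and> x a \<noteq> y b \<and> y a \<noteq> z b" if "a \<in> V" "b \<in> V" for a b
    using inV[OF that(1)] inV[OF that(2)] disj by (metis disjoint_iff)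
  have T_inj: "a = a' \<and> b = b'" if "a \<in> V" "b \<in> V" "a' \<in> V" "b' \<in> V"
    "{x a, z a, y b} = {x a', z a', y b'}" for a b a' b'
  proof -
    have "x a \<in> {x a', z a', y b'}" "y b \<in> {x a', z a', y b'}" using that(5) by auto
    moreover have "x a \<noteq> z a'" "x a \<noteq> y b'" "y b \<noteq> x a'" "y b \<noteq> z a'"
      using that ne by metis+
    ultimately have "x a = x a'" "y b = y b'" by auto
    then show ?thesis using that inj by (auto dest: inj_onD)
  qed
  have zeq: "a = b" if "a \<in> U1" "b \<in> U1" "\<rho> a = \<rho> b" "\<rho> a \<noteq> a" "\<rho> b \<noteq> b" for a b
  proof (rule ccontr)
    assume "a \<noteq> b"
    then have e: "{a, b} \<in> M" using \<rho>eq that by blast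
    then show False using KM[OF e, of a] \<rho>K[of a] that by auto
  qed
  have inj_i: "inj_on i V"
  proof (rule inj_onI)
    fix a b assume ab: "a \<in> V" "b \<in> V" "i a = i b"
    then have cs: "a \<in> U2 \<or> a \<in> U1 \<and> a \<notin> U2 \<and> \<rho> a \<in> V" "b \<in> U2 \<or> b \<in> U1 \<and> b \<notin> U2 \<and> \<rho> b \<in> V"
      using U \<rho>U by auto
    show "a = b"
      using cs ab inV[OF ab(1)] inV[OF ab(2)] inV[of "\<rho> a"] inV[of "\<rho> b"] disj
        inj_onD[OF inj(1), of a b] inj_onD[OF inj(2), of a b] inj_onD[OF inj(3), of "\<rho> a"
          "\<rho> b"] zeq[of a b]
      unfolding i_def disjoint_iff by (smt (verit))
  qed
  have TW: "x a \<in> W" "z a \<in> W" "y a \<in> W" if "a \<in> V" for a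
    using T[OF that that] H by (auto simp: uniform_hypergraph_def)
  have iW: "i ` V \<subseteq> W"
  proof
    fix w assume "w \<in> i ` V"
    then obtain a where a: "a \<in> V" "w = i a" by blast
    then show "w \<in> W" using TW[of a] TW[of "\<rho> a"] U \<rho>U[of a] by (auto simp: i_def)
  qed
  have i1: "i a \<in> {x (\<rho> a), z (\<rho> a), y b}" if "a \<in> U1" for a b
    using that U by (auto simp: i_def)
  \<comment> \<open>A matching edge with representative \<open>r\<close> gets the tip \<open>y r\<close>. Since \<open>r \<in> U1\<close>, no edge between
    \<open>U1\<close> and \<open>U2\<close> uses that tip.\<close>
  define R where "R e h \<longleftrightarrow> (\<exists>a\<in>U1. \<exists>b\<in>U2. e = {a, b} \<and> h = {x (\<rho> a), z (\<rho> a), y b}) \<or>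
      (\<exists>a\<in>U1. \<exists>b\<in>U1. e = {a, b} \<and> e \<in> M \<and> \<rho> b = \<rho> a \<and> h = {x (\<rho> a), z (\<rho> a), y (\<rho> a)})" for e h
  have "\<exists>h. R e h" if e: "e \<in> E" for e
  proof (cases "e \<in> M")
    case True
    then obtain a b where ab: "e = {a, b}" using M(2)[of e] by (auto simp: card_2_iff)
    then have "a \<in> U1" "b \<in> U1" "\<rho> b = \<rho> a" using M(1)[OF True] \<rho>M True by auto
    then show ?thesis using ab True unfolding R_def by blast
  next
    case False
    then show ?thesis using UF[of e] e unfolding R_def M_def by blast
  qed
  then obtain f where f: "\<And>e. e \<in> E \<Longrightarrow> R e (f e)" by metis
  have "inj_on f E"
  proof (rule inj_onI)
    fix e e' assume e: "e \<in> E" "e' \<in> E" "f e = f e'"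
    show "e = e'" using f[OF e(1)] f[OF e(2)] unfolding R_def e(3)
    proof (elim disjE bexE conjE, goal_cases)
      case (1 a a' b b')
      then have *: "\<rho> a = \<rho> a' \<and> b = b'" using T_inj[of "\<rho> a" b "\<rho> a'" b'] U \<rho>U by auto
      show ?case
      proof (cases "a = a'")
        case False
        \<comment> \<open>Here \<open>a\<close> and \<open>a'\<close> are the ends of a matching
          edge and both are adjacent to \<open>b\<close>: a triangle.\<close>
        then have "{a, a'} \<in> E" using * \<rho>eq by (auto simp: M_def)
        moreover have "{a, b} \<in> E" "{a', b} \<in> E" using 1 e * by auto
        moreover have "a \<noteq> b" "a' \<noteq> b" using 1 U * by auto
        ultimately have False using False triangle_freeD[OF G(2), of a a' b] by blast
        then show ?thesis ..
      qed (use 1 * in auto)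
    next
      case (2 a a' b b')
      then show ?case using T_inj[of "\<rho> a" b "\<rho> a'" "\<rho> a'"] U \<rho>U by blast
    next
      case (3 a a' b b')
      then show ?case using T_inj[of "\<rho> a'" b' "\<rho> a" "\<rho> a"] U \<rho>U by blast
    next
      case (4 a a' b b')
      then have "\<rho> a = \<rho> a'" using T_inj[of "\<rho> a" "\<rho> a" "\<rho> a'" "\<rho> a'"] U \<rho>U by blast
      then have "a = a' \<or> {a, a'} \<in> M" using \<rho>eq by auto
      moreover have "e \<in> M" "e' \<in> M" "a \<in> e" "a' \<in> e'" using 4 by auto
      ultimately show ?case using Meq[of e e' a] Meq[of e "{a, a'}" a] Meq[of e' "{a, a'}" a'] by auto
    qed
  qed
  moreover have "f ` E \<subseteq> H"
  proof
    fix h assume "h \<in> f ` E"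
    then obtain e where e: "R e h" using f by blast
    then show "h \<in> H" unfolding R_def using T U \<rho>U by blast
  qed
  moreover have "{i a, i b} \<subseteq> f {a, b}" if e: "{a, b} \<in> E" for a b
    using f[OF e] unfolding R_def
  proof (elim disjE bexE conjE)
    fix c c' assume c: "c \<in> U1" "c' \<in> U2" "{a, b} = {c, c'}" "f {a, b} = {x (\<rho> c), z (\<rho> c), y c'}"
    then have "{i c, i c'} \<subseteq> f {a, b}" using i1[of c c'] by (simp add: i_def)
    moreover have "{i a, i b} = {i c, i c'}" using c(3) by (auto simp: doubleton_eq_iff)
    ultimately show ?thesis by simp
  next
    fix c c' assume c: "c \<in> U1" "c' \<in> U1" "{a, b} = {c, c'}" "\<rho> c' = \<rho> c"
      "f {a, b} = {x (\<rho> c), z (\<rho> c), y (\<rho> c)}"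
    then have "{i c, i c'} \<subseteq> f {a, b}" using i1[of c "\<rho> c"] i1[of c' "\<rho> c"] by simp
    moreover have "{i a, i b} = {i c, i c'}" using c(3) by (auto simp: doubleton_eq_iff)
    ultimately show ?thesis by simp
  qed
  ultimately show ?thesis by (rule not_Berge_free_if_edge_injection[OF H inj_i iW])
qed

subsection \<open>Dense shadows\<close>

text \<open>Each shadow pair is assigned a hyperedge \<open>\<phi> e\<close> containing it, and each
  hyperedge so used picks back one of its pairs, oriented arbitrarily, by \<open>\<psi>\<close>.
  Then \<open>g\<close> inverts \<open>\<psi>\<close> and is injective on \<open>D\<close>. A
  hyperedge contains only three pairs, whence the factor 3.\<close>

lemma shadow_representatives:
  assumes H: "three_graph W H"
  obtains D g where "D \<subseteq> W \<times> W" "inj_on g D"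
    "\<And>x y. (x, y) \<in> D \<Longrightarrow> x \<noteq> y \<and> g (x, y) \<in> H \<and> {x, y} \<subseteq> g (x, y)" "card (shadow W H) \<le> 3 * card D"
proof -
  define S where "S = shadow W H"
  have W: "finite W" and H3: "\<And>h. h \<in> H \<Longrightarrow> h \<subseteq> W \<and> card h = 3"
    using H by (auto simp: uniform_hypergraph_def)
  have S: "\<exists>u v. e = {u, v} \<and> u \<in> W \<and> v \<in> W \<and> u \<noteq> v" "\<exists>h\<in>H. e \<subseteq> h" if "e \<in> S" for e
    using that by (auto simp: S_def shadow_def)
  obtain \<phi> where \<phi>: "\<And>e. e \<in> S \<Longrightarrow> \<phi> e \<in> H \<and> e \<subseteq> \<phi> e" using S(2) by metis
  have "S \<subseteq> Pow W" by (auto simp: S_def shadow_def)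
  then have finS: "finite S" using W finite_subset by blast
  have "\<exists>xy. fst xy \<noteq> snd xy \<and> {fst xy, snd xy} \<in> S \<and> \<phi> {fst xy, snd xy} = h" if h: "h \<in> \<phi> ` S" for h
  proof -
    obtain e where e: "e \<in> S" "\<phi> e = h" using h by blast
    obtain u v where "e = {u, v}" "u \<noteq> v" using S(1)[OF e(1)] by blast
    then show ?thesis using e by (intro exI[of _ "(u, v)"]) auto
  qed
  then obtain \<psi> where \<psi>: "\<And>h. h \<in> \<phi> ` S \<Longrightarrow> fst (\<psi> h) \<noteq> snd (\<psi> h) \<and> {fst (\<psi> h), snd (\<psi> h)} \<in> S \<and>
      \<phi> {fst (\<psi> h), snd (\<psi> h)} = h" by metis
  define D where "D = \<psi> ` \<phi> ` S"
  define g where "g xy = \<phi> {fst xy, snd xy}" for xy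
  have g: "g (\<psi> h) = h" if "h \<in> \<phi> ` S" for h using \<psi>[OF that] by (simp add: g_def)
  have D: "x \<noteq> y \<and> {x, y} \<in> S" if "(x, y) \<in> D" for x y
    using that \<psi> unfolding D_def by (metis imageE fst_conv snd_conv)
  have cardD: "card D = card (\<phi> ` S)"
    unfolding D_def by (rule card_image) (metis g inj_on_inverseI)
  have "S = (\<Union>h\<in>\<phi> ` S. {e \<in> S. \<phi> e = h})" by auto
  then have "card S \<le> (\<Sum>h\<in>\<phi> ` S. card {e \<in> S. \<phi> e = h})"
    using card_UN_le[of "\<phi> ` S" "\<lambda>h. {e \<in> S. \<phi> e = h}"] finS by simp
  also have "\<dots> \<le> (\<Sum>h\<in>\<phi> ` S. 3)"
  proof (rule sum_mono)
    fix h assume h: "h \<in> \<phi> ` S"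
    then have "card h = 3" using \<phi> H3 by auto
    then have h3: "card h = 3" "finite h" using card_ge_0_finite[of h] by auto
    have "{e \<in> S. \<phi> e = h} \<subseteq> {e. e \<subseteq> h \<and> card e = 2}"
    proof safe
      fix e assume e: "e \<in> S"
      show "w \<in> \<phi> e" if "w \<in> e" for w using \<phi>[OF e] that by blast
      show "card e = 2" using S(1)[OF e] by auto
    qed
    then have "card {e \<in> S. \<phi> e = h} \<le> card {e. e \<subseteq> h \<and> card e = 2}"
      using h3 by (intro card_mono) auto
    also have "\<dots> = 3 choose 2" using n_subsets[OF h3(2), of 2] h3(1) by simp
    also have "\<dots> = 3" by (simp add: choose_two)
    finally show "card {e \<in> S. \<phi> e = h} \<le> 3" .
  qed
  finally have "card S \<le> 3 * card D" by (simp add: cardD)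
  moreover have "D \<subseteq> W \<times> W"
  proof
    fix e assume "e \<in> D"
    then have "{fst e, snd e} \<in> S" using D[of "fst e" "snd e"] by simp
    then show "e \<in> W \<times> W" using \<open>S \<subseteq> Pow W\<close> by (cases e) auto
  qed
  moreover have "inj_on g D" unfolding D_def by (rule inj_onI) (metis g imageE)
  moreover have "x \<noteq> y \<and> g (x, y) \<in> H \<and> {x, y} \<subseteq> g (x, y)" if "(x, y) \<in> D" for x y
    using D[OF that] \<phi>[of "{x, y}"] by (simp add: g_def)
  ultimately show thesis using that unfolding S_def by blast
qed

text \<open>If the edges outside the set \<open>A\<close> of popular edges were still
  \<gamma>-dense, one of them would lie in many 4-cycles formed by such edges alone. These are
  4-cycles of \<open>D\<close> as well, so that edge would be popular.\<close>

lemma most_edges_in_many_4_cycles: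
  fixes \<gamma> :: real
  assumes W: "finite W" "W \<noteq> {}" and D: "D \<subseteq> W \<times> W" "2 * \<gamma> * card W ^ 2 \<le> card D" and \<gamma>: "\<gamma> > 0"
  shows "\<gamma> * card W ^ 2 \<le>
    card {(x, y) \<in> D. \<gamma> ^ 4 * card W ^ 2 \<le> card {(p, q) \<in> D. (x, q) \<in> D \<and> (p, y) \<in> D}}"
proof -
  define C where "C S x y = {(p, q) \<in> S. (x, q) \<in> S \<and> (p, y) \<in> S}" for S :: "('a \<times> 'a) set" and x y
  define A where "A = {(x, y) \<in> D. \<gamma> ^ 4 * card W ^ 2 \<le> card (C D x y)}"
  have n: "real (card W ^ 2) > 0" using W by (simp add: card_gt_0_iff)
  have finD: "finite D" using D W finite_subset by blast
  have "card (D - A) < \<gamma> * card W ^ 2"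
  proof (rule ccontr)
    assume "\<not> ?thesis"
    then have le: "\<gamma> * card W ^ 2 \<le> card (D - A)" by simp
    have "\<gamma> * real (card W ^ 2) > 0" using n \<gamma> by simp
    then have ne: "D - A \<noteq> {}" using le by (metis card.empty not_le of_nat_0)
    obtain x y where xy: "(x, y) \<in> D - A" "\<gamma> ^ 4 * card W ^ 2 \<le> card (C (D - A) x y)"
      using exists_edge_in_many_4_cycles[OF W(1) _ ne _ le] D \<gamma> unfolding C_def by auto
    have "card (C (D - A) x y) \<le> card (C D x y)"
      using finD by (intro card_mono) (auto simp: C_def intro: finite_subset)
    then have "\<gamma> ^ 4 * card W ^ 2 \<le> card (C D x y)" using xy(2) by linarith
    then show False using xy(1) by (auto simp: A_def)
  qed
  moreover have "card D = card A + card (D - A)"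
    using finD by (subst card_Un_disjoint[symmetric]) (auto simp: A_def intro!: arg_cong[where f = card] intro: finite_subset)
  ultimately have "\<gamma> * card W ^ 2 \<le> card A" using D(2) by simp
  then show ?thesis by (simp add: A_def C_def)
qed

section \<open>Matchings and stars in a link\<close>

definition pair_matching :: "('w \<times> 'w) set \<Rightarrow> bool" where
  "pair_matching M \<longleftrightarrow> (\<forall>e\<in>M. \<forall>e'\<in>M. e \<noteq> e' \<longrightarrow> {fst e, snd e} \<inter> {fst e', snd e'} = {})"

text \<open>A maximum matching has fewer than \<open>R\<close> edges, so the set \<open>T\<close> of
  its endpoints has at most 2 R elements. By maximality \<open>T\<close> meets every pair of
  \<open>L\<close>, and averaging over \<open>T\<close> yields a large star.\<close>

lemma exists_large_star:
  assumes L: "finite L" and no: "\<And>M. M \<subseteq> L \<Longrightarrow> pair_matching M \<Longrightarrow> card M \<noteq> R"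
  shows "\<exists>u. card L \<le> 2 * R * card {e \<in> L. fst e = u \<or> snd e = u}"
proof -
  define S where "S u = {e \<in> L. fst e = u \<or> snd e = u}" for u
  have "\<exists>M. (M \<subseteq> L \<and> pair_matching M) \<and> (\<forall>M'. M' \<subseteq> L \<and> pair_matching M' \<longrightarrow> card M' \<le> card M)"
    by (rule ex_has_greatest_nat[of _ "{}" _ "Suc (card L)"]) (auto simp: pair_matching_def L card_mono less_Suc_eq_le)
  then obtain M where M: "M \<subseteq> L" "pair_matching M"
    and max: "\<And>M'. M' \<subseteq> L \<Longrightarrow> pair_matching M' \<Longrightarrow> card M' \<le> card M"
    by blast
  have finM: "finite M" using M L finite_subset by blast
  \<comment> \<open>Only matchings of size exactly \<open>R\<close> are excluded, so a larger one is
    first cut down to that size.\<close>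
  have "card M < R"
  proof (rule ccontr)
    assume "\<not> card M < R"
    then obtain M' where "M' \<subseteq> M" "card M' = R" by (meson linorder_not_less obtain_subset_with_card_n)
    moreover from this have "pair_matching M'" using M(2) unfolding pair_matching_def by blast
    ultimately show False using no M(1) by blast
  qed
  define T where "T = fst ` M \<union> snd ` M"
  have finT: "finite T" using finM by (simp add: T_def)
  have "card T \<le> 2 * card M"
    unfolding T_def using card_Un_le[of "fst ` M"
      "snd ` M"] card_image_le[OF finM, of fst] card_image_le[OF finM, of snd] by linarith
  then have cT: "card T \<le> 2 * R" using \<open>card M < R\<close> by linarith
  have "L \<subseteq> (\<Union>u\<in>T. S u)"
  proof
    fix e assume e: "e \<in> L"
    have "fst e \<in> T \<or> snd e \<in> T"
    proof (rule ccontr)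
      assume *: "\<not> ?thesis"
      then have "e \<notin> M" by (auto simp: T_def)
      have "pair_matching (insert e M)"
        unfolding pair_matching_def
      proof (intro ballI impI)
        fix a b assume ab: "a \<in> insert e M" "b \<in> insert e M" "a \<noteq> b"
        have T: "fst c \<in> T" "snd c \<in> T" if "c \<in> M" for c using that by (auto simp: T_def)
        show "{fst a, snd a} \<inter> {fst b, snd b} = {}"
        proof (cases "a \<in> M \<and> b \<in> M")
          case True
          then show ?thesis using M(2) ab(3) unfolding pair_matching_def by blast
        next
          case False
          then have "a = e \<and> b \<in> M \<or> a \<in> M \<and> b = e" using ab by blast
          then show ?thesis using * T[of a] T[of b] by auto
        qed
      qed
      then have "card (insert e M) \<le> card M" using max[of "insert e M"] e M(1) by simp
      then show False using \<open>e \<notin> M\<close> finM by simp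
    qed
    then show "e \<in> (\<Union>u\<in>T. S u)" using e by (auto simp: S_def)
  qed
  then have "card L \<le> card (\<Union>u\<in>T. S u)" using L finT by (intro card_mono) (auto simp: S_def)
  also have "\<dots> \<le> (\<Sum>u\<in>T. card (S u))" by (rule card_UN_le[OF finT])
  finally have sum: "card L \<le> (\<Sum>u\<in>T. card (S u))" .
  show ?thesis
  proof (cases "T = {}")
    case True
    then show ?thesis using sum by simp
  next
    case False
    then have "Max ((\<lambda>w. card (S w)) ` T) \<in> (\<lambda>w. card (S w)) ` T" using finT by (intro Max_in) auto
    then obtain u where u: "u \<in> T" "Max ((\<lambda>w. card (S w)) ` T) = card (S u)" by blast
    have le: "card (S w) \<le> card (S u)" if "w \<in> T" for w
      unfolding u(2)[symmetric] using finT that by (intro Max_ge) auto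
    have "(\<Sum>w\<in>T. card (S w)) \<le> card T * card (S u)"
      using sum_bounded_above[of T _ "card (S u)"] le by simp
    also have "\<dots> \<le> 2 * R * card (S u)" using cT by simp
    finally show ?thesis using sum unfolding S_def by (intro exI[of _ u]) linarith
  qed
qed

text \<open>The set \<open>X\<close> of \<open>z\<close> and all endpoints in \<open>J\<close> has
  at most 2 |V| + 1 elements, so |V| vertices remain in each of \<open>P\<close> and
  \<open>Q\<close> after removing it. This gives disjoint ranges for the embedding with apex
  \<open>z\<close>.\<close>

lemma Berge_copy_from_link_matching:
  assumes G: "simple_graph V E" "triangle_free E" "v \<in> V"
    "bipartite (V - {v}) (induced_edges E (V - {v}))"
    and H: "three_graph W H" and D: "D \<subseteq> W \<times> W" "inj_on g D"
      "\<And>x y. (x, y) \<in> D \<Longrightarrow> x \<noteq> y \<and> g (x, y) \<in> H \<and> {x, y} \<subseteq> g (x, y)"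
    and J: "J \<subseteq> D" "pair_matching J" "card J = card V" "\<And>e. e \<in> J \<Longrightarrow> z \<in> g e \<and> z \<noteq> fst e \<and> z \<noteq> snd e"
      "z \<in> W"
    and PQ: "card P = 3 * card V + 1" "card Q = 3 * card V + 1" "P \<times> Q \<subseteq> D"
      "\<forall>(x, y)\<in>J. {x} \<times> Q \<subseteq> D \<and> P \<times> {y} \<subseteq> D"
  shows "\<not> Berge_free V E W H"
proof -
  have V: "finite V" "card V > 0" using G(1,3) by (auto simp: uniform_hypergraph_def card_gt_0_iff)
  have finJ: "finite J" using J(3) V(2) card_ge_0_finite[of J] by simp
  define X where "X = insert z (fst ` J \<union> snd ` J)"
  have finX: "finite X" using finJ by (simp add: X_def)
  have "card (fst ` J \<union> snd ` J) \<le> 2 * card V"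
    using card_Un_le[of "fst ` J" "snd ` J"] card_image_le[OF finJ, of fst] card_image_le[OF finJ, of snd] J(3)
    by linarith
  then have cX: "card X \<le> 2 * card V + 1"
    using card_insert_le_m1[of "2 * card V + 1" "fst ` J \<union> snd ` J" z] unfolding X_def by simp
  have sub: "\<exists>q. inj_on q V \<and> q ` V \<subseteq> S - X" if "card S = 3 * card V + 1" for S
  proof -
    have "card V \<le> card (S - X)" using diff_card_le_card_Diff[OF finX, of S] that cX by linarith
    moreover have "finite (S - X)" using that card_ge_0_finite[of S] by simp
    ultimately show ?thesis using card_le_inj[OF V(1)] by blast
  qed
  obtain p where p: "inj_on p V" "p ` V \<subseteq> P - X" using sub[OF PQ(1)] by blast
  obtain q where q: "inj_on q V" "q ` V \<subseteq> Q - X" using sub[OF PQ(2)] by blast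
  obtain \<beta> where \<beta>: "bij_betw \<beta> V J" using finite_same_card_bij[OF V(1) finJ] J(3) by metis
  have \<beta>J: "\<beta> a \<in> J" if "a \<in> V" for a using \<beta> that by (auto simp: bij_betw_def)
  define x where "x a = fst (\<beta> a)" for a
  define y where "y a = snd (\<beta> a)" for a
  have xyD: "(x a, y a) \<in> J" if "a \<in> V" for a using \<beta>J[OF that] by (simp add: x_def y_def)
  have sep: "x a \<noteq> x b \<and> y a \<noteq> y b" if "a \<in> V" "b \<in> V" "a \<noteq> b" for a b
  proof -
    have "\<beta> a \<noteq> \<beta> b" using \<beta> that by (auto simp: bij_betw_def dest: inj_onD)
    then show ?thesis using J(2) \<beta>J that unfolding pair_matching_def x_def y_def by blast
  qed
  have sep2: "x a \<noteq> y b" if "a \<in> V" "b \<in> V" for a b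
  proof (cases "a = b")
    case True
    then show ?thesis using D(3)[of "x a" "y a"] xyD[OF that(1)] J(1) by blast
  next
    case False
    then have "\<beta> a \<noteq> \<beta> b" using \<beta> that by (auto simp: bij_betw_def dest: inj_onD)
    then show ?thesis using J(2) \<beta>J that unfolding pair_matching_def x_def y_def by blast
  qed
  have X: "x ` V \<subseteq> X" "y ` V \<subseteq> X" "z \<in> X" using \<beta>J by (auto simp: X_def x_def y_def)
  have pV: "p a \<in> P" and qV: "q a \<in> Q" if "a \<in> V" for a using that p(2) q(2) by auto
  obtain A B where AB: "bipartition (V - {v}) (induced_edges E (V - {v})) A B"
    using G(4) by (auto simp: bipartite_def)
  show ?thesis
  proof (rule Berge_copy_with_apex[OF G(1-3) AB H D(1,2), where x = x and y = y and z = z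
    and p = p and q = q])
    show "g (a, b) \<in> H \<and> {a, b} \<subseteq> g (a, b)" if "(a, b) \<in> D" for a b using D(3)[OF that] by blast
    show "(x a, y a) \<in> D \<and> z \<in> g (x a, y a)" if "a \<in> V" for a using xyD[OF that] J(1,4) by blast
    show "z \<in> W" by (rule J(5))
    show "(x a, q b) \<in> D \<and> (p a, q b) \<in> D \<and> (p a, y b) \<in> D" if "a \<in> V" "b \<in> V" for a b
      using PQ(3,4) xyD[OF that(1)] xyD[OF that(2)] pV[OF that(1)] qV[OF that(2)] by blast
    show "inj_on x V" "inj_on y V" using sep by (meson inj_onI)+
    show "inj_on p V" "inj_on q V" by (rule p, rule q)
    show "x ` V \<inter> y ` V = {}" using sep2 by auto
    show "x ` V \<inter> p ` V = {}" "x ` V \<inter> q ` V = {}" "y ` V \<inter> p ` V = {}" "y ` V \<inter> q ` V = {}"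
      using X p(2) q(2) by blast+
    show "p ` V \<inter> q ` V = {}"
    proof -
      \<comment> \<open>All pairs of \<open>P\<close> with \<open>Q\<close> lie in \<open>D\<close>,
        which contains no loops, so \<open>P\<close> and \<open>Q\<close> are disjoint.\<close>
      have "p a \<noteq> q b" if "a \<in> V" "b \<in> V" for a b
        using D(3)[of "p a" "q b"] PQ(3) pV[OF that(1)] qV[OF that(2)] by blast
      then show ?thesis by auto
    qed
    have "z \<noteq> x a \<and> z \<noteq> y a" if "a \<in> V" for a using J(4)[OF xyD[OF that]] by simp
    then have "z \<notin> x ` V" "z \<notin> y ` V" by blast+
    then show "z \<notin> x ` V \<union> y ` V \<union> p ` V \<union> q ` V" using X(3) p(2) q(2) by blast
  qed
qed

text \<open>The doubled points are the pairs of \<open>z\<close> and \<open>u z\<close>, and the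
  tips are the common leaves. Since every hyperedge has three distinct vertices, the leaves avoid
  both \<open>J\<close> and its image under \<open>u\<close>. The two parts are interchanged if the
  matching lies in \<open>U2\<close>.\<close>

lemma Berge_copy_from_stars:
  assumes G: "simple_graph V E" "V \<noteq> {}" "triangle_free E" "F \<subseteq> E" "bipartition V F U1 U2"
    "matching (E - F)"
      "(\<forall>e\<in>E - F. e \<subseteq> U1) \<or> (\<forall>e\<in>E - F. e \<subseteq> U2)"
    and H: "three_graph W H" and J: "card J = card V" "card B = card V" "inj_on u J" "u ` J \<inter> J = {}"
      "\<And>z b. z \<in> J \<Longrightarrow> b \<in> B \<Longrightarrow> {u z, z, b} \<in> H"
  shows "\<not> Berge_free V E W H"
proof -
  have V: "finite V" "card V > 0" using G(1,2) by (auto simp: uniform_hypergraph_def card_gt_0_iff)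
  then have fin: "finite J" "finite B" using J(1,2) card_ge_0_finite[of J] card_ge_0_finite[of B]
    by simp_all
  obtain z where z: "bij_betw z V J" using finite_same_card_bij[OF V(1) fin(1)] J(1) by metis
  obtain y where y: "bij_betw y V B" using finite_same_card_bij[OF V(1) fin(2)] J(2) by metis
  have zJ: "z ` V = J" "inj_on z V" and yB: "y ` V = B" "inj_on y V"
    using y z by (auto simp: bij_betw_def)
  have B: "b \<noteq> u c \<and> b \<noteq> c" if "c \<in> J" "b \<in> B" for b c
  proof -
    have "card {u c, c, b} = 3" using J(5)[OF that] H unfolding uniform_hypergraph_def by blast
    then show ?thesis by (auto simp: card_insert_if split: if_splits)
  qed
  obtain U1' U2' where U: "bipartition V F U1' U2'" "\<forall>e\<in>E - F. e \<subseteq> U1'"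
  proof (cases "\<forall>e\<in>E - F. e \<subseteq> U1")
    case True
    then show thesis using that G(5) by blast
  next
    case False
    moreover have "bipartition V F U2 U1"
      using G(5) unfolding bipartition_def by (metis Un_commute Int_commute insert_commute)
    ultimately show thesis using that G(7) by blast
  qed
  have uz: "(u \<circ> z) ` V = u ` J" using zJ(1) by (metis image_comp)
  show ?thesis
  proof (rule Berge_copy_in_doubled_biclique[OF G(1,3,4) U(1) G(6) U(2) H, where x = "u \<circ> z"
    and y = y and z = z])
    show "{(u \<circ> z) a, z a, y b} \<in> H" if "a \<in> V" "b \<in> V" for a b
      using J(5)[of "z a" "y b"] zJ(1) yB(1) that by auto
    show "inj_on (u \<circ> z) V" using zJ J(3) by (simp add: comp_inj_on)
    show "inj_on y V" "inj_on z V" by (rule yB, rule zJ)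
    have "u c \<noteq> b" "b \<noteq> c" if "c \<in> J" "b \<in> B" for b c using B[OF that] by auto
    then have "u ` J \<inter> B = {}" "B \<inter> J = {}" by auto
    then show "(u \<circ> z) ` V \<inter> y ` V = {}" "y ` V \<inter> z ` V = {}"
      unfolding uz zJ yB .
    show "(u \<circ> z) ` V \<inter> z ` V = {}" using J(4) unfolding uz zJ .
  qed
qed

text \<open>Either some link contains a matching of \<open>R\<close> popular pairs, which leads to
  the copy with an apex, or every link has a star holding a fixed share of its popular pairs, which
  leads to the copy in a doubled biclique.\<close>

lemma dense_shadow_contains_Berge_copy:
  fixes \<epsilon> :: real
  assumes G: "simple_graph V E" "V \<noteq> {}" "triangle_free E"
    "v \<in> V" "bipartite (V - {v}) (induced_edges E (V - {v}))"
    "F \<subseteq> E" "bipartition V F U1 U2" "matching (E - F)" "(\<forall>e\<in>E - F. e \<subseteq> U1) \<or> (\<forall>e\<in>E - F. e \<subseteq> U2)"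
    and \<epsilon>: "\<epsilon> > 0"
  shows "\<exists>N. \<forall>(W :: 'w set) H. three_graph W H \<longrightarrow> N \<le> card W \<longrightarrow>
      \<epsilon> * card W ^ 2 \<le> card (shadow W H) \<longrightarrow> \<not> Berge_free V E W H"
proof -
  \<comment> \<open>A shadow of size \<epsilon> n^2 leaves at least \<epsilon> n^2 / 3 = 2 \<gamma>
    n^2 representatives in \<open>D\<close>; half of this bound survives for the popular
    pairs.\<close>
  define \<gamma> where "\<gamma> = \<epsilon> / 6"
  have \<gamma>: "\<gamma> > 0" "\<gamma> ^ 4 > 0" using \<epsilon> by (auto simp: \<gamma>_def)
  have "3 * card V + 1 > 0" by simp
  from matched_edges_extend_to_biclique[OF \<gamma>(2) this, where s = "card V"]
  obtain R N1 where RN: "\<And>(W :: 'w set) D M. finite W \<Longrightarrow> N1 \<le> card W \<Longrightarrow> D \<subseteq> W \<times> W \<Longrightarrow> M \<subseteq> D \<Longrightarrow> card M = R \<Longrightarrow>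
      (\<forall>(x, y)\<in>M. \<gamma> ^ 4 * card W ^ 2 \<le> card {(p, q) \<in> D. (x, q) \<in> D \<and> (p, y) \<in> D}) \<Longrightarrow>
    \<exists>J P Q. J \<subseteq> M \<and> card J = card V \<and> P \<subseteq> W \<and> Q \<subseteq> W \<and> card P = 3 * card V + 1 \<and>
      card Q = 3 * card V + 1 \<and>
      P \<times> Q \<subseteq> D \<and> (\<forall>(x, y)\<in>J. {x} \<times> Q \<subseteq> D \<and> P \<times> {y} \<subseteq> D)"
    by (elim exE) (rule that, iprover)
  \<comment> \<open>With \<gamma> = 8 (R + 1) \<beta>, passing to stars leaves a total of at least 4
    \<beta> n^2 pairs. Averaging then leaves \<beta> n stars of size 2 \<beta> n, and forgetting
    orientations leaves \<beta> n leaves in each.\<close>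
  define \<beta> where "\<beta> = \<gamma> / (8 * Suc R)"
  have \<beta>: "\<beta> > 0" using \<gamma> by (simp add: \<beta>_def)
  \<comment> \<open>This bounds how often one vertex is the centre of a star: stars belonging to
    different \<open>z\<close> are disjoint sets of pairs, each of size at least 2 \<beta> n, and at
    most 2 n pairs contain a given vertex.\<close>
  define K where "K = nat \<lceil>1 / \<beta>\<rceil>"
  from many_large_stars_yield_common_leaves[OF \<beta>, where K = K and t = "card V"]
  obtain N2 where N2: "\<And>(W :: 'w set) Z u A. finite W \<Longrightarrow> N2 \<le> card W \<Longrightarrow> Z \<subseteq> W \<Longrightarrow> \<beta> * card W \<le> card Z \<Longrightarrow>
     (\<forall>z\<in>Z. u z \<noteq> z \<and> A z \<subseteq> W \<and> \<beta> * card W \<le> card (A z)) \<Longrightarrow> (\<forall>w. card {z \<in> Z. u z = w} \<le> K) \<Longrightarrow>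
    \<exists>J B. J \<subseteq> Z \<and> card J = card V \<and> inj_on u J \<and> u ` J \<inter> J = {} \<and> card B = card V \<and> (\<forall>z\<in>J. B \<subseteq> A z)"
    by (elim exE) (rule that, iprover)
  show ?thesis
  proof (intro exI[of _ "Suc (N1 + N2)"] allI impI)
    fix W :: "'w set" and H
    assume H: "three_graph W H" and N: "Suc (N1 + N2) \<le> card W"
      and sh: "\<epsilon> * card W ^ 2 \<le> card (shadow W H)"
    have W: "finite W" "W \<noteq> {}" "N1 \<le> card W" "N2 \<le> card W" "real (card W) > 0"
      using H N by (auto simp: uniform_hypergraph_def)
    obtain D g where D: "D \<subseteq> W \<times> W" "inj_on g D"
        "\<And>x y. (x, y) \<in> D \<Longrightarrow> x \<noteq> y \<and> g (x, y) \<in> H \<and> {x, y} \<subseteq> g (x, y)" "card (shadow W H) \<le> 3 * card D"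
      by (rule shadow_representatives[OF H]) blast
    have finD: "finite D" using D(1) W(1) finite_subset by blast
    define L where "L = {(x, y) \<in> D. \<gamma> ^ 4 * card W ^ 2 \<le> card {(p, q) \<in> D. (x, q) \<in> D \<and> (p, y) \<in> D}}"
    have "2 * \<gamma> * card W ^ 2 \<le> card D" using sh D(4) unfolding \<gamma>_def by simp
    from most_edges_in_many_4_cycles[OF W(1,2) D(1) this \<gamma>(1)]
    have cL: "\<gamma> * card W ^ 2 \<le> card L" by (simp add: L_def)
    have LD: "L \<subseteq> D" by (auto simp: L_def)
    have finL: "finite L" using LD finD finite_subset by blast
    have third: "\<exists>z. g e = {fst e, snd e, z} \<and> z \<noteq> fst e \<and> z \<noteq> snd e \<and> z \<in> W" if "e \<in> D" for e
    proof -
      have e: "fst e \<noteq> snd e" "g e \<in> H" "{fst e, snd e} \<subseteq> g e"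
        using D(3)[of "fst e" "snd e"] that by auto
      have g: "card (g e) = 3" "g e \<subseteq> W" using H e(2) by (auto simp: uniform_hypergraph_def)
      then have "finite (g e)" using card_ge_0_finite[of "g e"] by simp
      then have "card (g e - {fst e, snd e}) = 1" using e g by (simp add: card_Diff_subset)
      then obtain z where z: "g e - {fst e, snd e} = {z}" by (auto simp: card_1_singleton_iff)
      then have "g e = {fst e, snd e, z}" using e(3) by blast
      moreover have "z \<noteq> fst e" "z \<noteq> snd e" "z \<in> W" using z g(2) by auto
      ultimately show ?thesis by blast
    qed
    then obtain c where c: "\<And>e. e \<in> D \<Longrightarrow> g e = {fst e, snd e, c e} \<and> c e \<noteq> fst e \<and> c e \<noteq> snd e \<and> c e \<in> W"
      by metis
    \<comment> \<open>Popular pairs sorted by the third vertex of their hyperedge: the part of the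
      link of \<open>z\<close> that is represented in \<open>L\<close>.\<close>
    define Lk where "Lk z = {e \<in> L. c e = z}" for z
    show "\<not> Berge_free V E W H"
    proof (cases "\<exists>z\<in>W. \<exists>M\<subseteq>Lk z. pair_matching M \<and> card M = R")
      case True
      then obtain z M where z: "z \<in> W" and M: "M \<subseteq> Lk z" "pair_matching M" "card M = R" by blast
      have MD: "M \<subseteq> D" "\<forall>(x, y)\<in>M. \<gamma> ^ 4 * card W ^ 2 \<le> card {(p, q) \<in> D. (x, q) \<in> D \<and> (p, y) \<in> D}"
        using M(1) by (auto simp: Lk_def L_def)
      obtain J P Q where J: "J \<subseteq> M" "card J = card V"
        and PQ: "card P = 3 * card V + 1" "card Q = 3 * card V + 1"
        "P \<times> Q \<subseteq> D" "\<forall>(x, y)\<in>J. {x} \<times> Q \<subseteq> D \<and> P \<times> {y} \<subseteq> D"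
        using RN[OF W(1,3) D(1) MD(1) M(3) MD(2)] by (elim exE conjE) (rule that; assumption)
      have "J \<subseteq> D" using J(1) MD(1) by blast
      moreover have "pair_matching J" using M(2) J(1) unfolding pair_matching_def by blast
      moreover have "z \<in> g e \<and> z \<noteq> fst e \<and> z \<noteq> snd e" if "e \<in> J" for e
      proof -
        have "e \<in> D" "c e = z" using that J(1) M(1) LD by (auto simp: Lk_def)
        then show ?thesis using c[of e] by auto
      qed
      ultimately show ?thesis
        using Berge_copy_from_link_matching[OF G(1,3,4,5) H D(1-3) _ _ J(2) _ z PQ] by blast
    next
      case no: False
      have R: "R > 0"
      proof (rule ccontr)
        assume "\<not> R > 0"
        moreover obtain z where "z \<in> W" using W(2) by blast
        moreover have "pair_matching {}" by (simp add: pair_matching_def)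
        ultimately show False using no by (metis card.empty empty_subsetI not_gr_zero)
      qed
      have ex: "\<exists>u. card (Lk z) \<le> 2 * R * card {e \<in> Lk z. fst e = u \<or> snd e = u}" if "z \<in> W" for z
        by (rule exists_large_star) (use no that finL in \<open>auto simp: Lk_def\<close>)
      define u where "u z = (SOME u. card (Lk z) \<le> 2 * R * card {e \<in> Lk z. fst e = u \<or> snd e = u})" for z
      have u: "card (Lk z) \<le> 2 * R * card {e \<in> Lk z. fst e = u z \<or> snd e = u z}" if "z \<in> W" for z
        unfolding u_def by (rule someI_ex[OF ex[OF that]])
      define S where "S z = {e \<in> Lk z. fst e = u z \<or> snd e = u z}" for z
      define St where "St w = {e \<in> W \<times> W. fst e = w \<or> snd e = w}" for w
      define A where "A z = {y. (u z, y) \<in> S z \<or> (y, u z) \<in> S z}" for z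
      have finS: "finite (S z)" for z using finL by (simp add: S_def Lk_def)
      have S: "e \<in> D \<and> c e = z \<and> (fst e = u z \<or> snd e = u z)" if "e \<in> S z" for e z
        using that LD by (auto simp: S_def Lk_def)
      have St: "finite (St w)" "card (St w) \<le> 2 * card W" for w
      proof -
        have sub: "St w \<subseteq> {w} \<times> W \<union> W \<times> {w}" by (auto simp: St_def)
        then show "finite (St w)" using W(1) finite_subset by blast
        have "card (St w) \<le> card ({w} \<times> W \<union> W \<times> {w})" using sub W(1) by (intro card_mono) auto
        also have "\<dots> \<le> card ({w} \<times> W) + card (W \<times> {w})" by (rule card_Un_le)
        finally show "card (St w) \<le> 2 * card W" by (simp add: card_cartesian_product)
      qed
      have SSt: "S z \<subseteq> St (u z)" for z using S D(1) by (force simp: St_def)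
      have S2: "card (S z) \<le> 2 * card W" for z
        using card_mono[OF St(1) SSt] St(2) le_trans by blast
      have "c ` L \<subseteq> W" using c LD by auto
      then have "card L = (\<Sum>z\<in>W. card (Lk z))"
        using sum_fun_comp[OF finL W(1), of c "\<lambda>_. 1::nat"] by (simp add: Lk_def)
      also have "\<dots> \<le> (\<Sum>z\<in>W. 2 * R * card (S z))" using u by (intro sum_mono) (simp add: S_def)
      also have "\<dots> = 2 * R * (\<Sum>z\<in>W. card (S z))" by (simp add: sum_distrib_left)
      also have "\<dots> \<le> 2 * Suc R * (\<Sum>z\<in>W. card (S z))" by simp
      finally have "real (card L) \<le> real (2 * Suc R * (\<Sum>z\<in>W. card (S z)))" by (rule of_nat_mono)
      then have "real (card L) \<le> 2 * real (Suc R) * real (\<Sum>z\<in>W. card (S z))"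
        by (simp only: of_nat_mult of_nat_numeral)
      moreover have "real (card W ^ 2) = real (card W) * real (card W)" by (simp add: power2_eq_square)
      moreover have "\<gamma> = 8 * real (Suc R) * \<beta>" by (simp add: \<beta>_def)
      ultimately have "2 * real (Suc R) * ((4 * \<beta> * card W) * card W) \<le> 2 * real (Suc R) * real (\<Sum>z\<in>W. card (S z))"
        using cL by (simp only: mult_ac)
      then have sum: "(4 * \<beta> * card W) * card W \<le> real (\<Sum>z\<in>W. card (S z))"
        by (rule mult_left_le_imp_le) simp
      define Z where "Z = {z \<in> W. 4 * \<beta> * card W / 2 \<le> card (S z)}"
      have "4 * \<beta> * card W / 2 * card W \<le> real (2 * card W) * card Z"
        unfolding Z_def of_nat_mult[symmetric] by (rule card_large_values[OF W(1) S2 sum])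
      then have Z: "\<beta> * card W \<le> card Z" using W(5) by simp
      have Zs: "2 * \<beta> * card W \<le> card (S z)" if "z \<in> Z" for z using that by (simp add: Z_def)
      have AW: "A z \<subseteq> W" for z unfolding A_def using S D(1) by blast
      have finA: "finite (A z)" for z using AW W(1) finite_subset by blast
      have cA: "\<beta> * card W \<le> card (A z)" if "z \<in> Z" for z
      proof -
        \<comment> \<open>A leaf may occur in both orientations, so \<open>S z\<close> has at most
          twice as many elements as \<open>A z\<close>.\<close>
        have "S z \<subseteq> Pair (u z) ` A z \<union> (\<lambda>y. (y, u z)) ` A z"
        proof
          fix e assume e: "e \<in> S z"
          then have "e = (u z, snd e) \<or> e = (fst e, u z)" using S[OF e] by (metis prod.collapse)
          then show "e \<in> Pair (u z) ` A z \<union> (\<lambda>y. (y, u z)) ` A z" using e unfolding A_def by auto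
        qed
        then have "card (S z) \<le> card (Pair (u z) ` A z \<union> (\<lambda>y. (y, u z)) ` A z)"
          using finA by (intro card_mono) auto
        also have "\<dots> \<le> card (A z) + card (A z)"
          using finA by (intro le_trans[OF card_Un_le] add_mono card_image_le)
        finally show ?thesis using Zs[OF that] by simp
      qed
      have uz: "u z \<noteq> z" if "z \<in> Z" for z
      proof -
        have "0 < 2 * \<beta> * card W" using \<beta> W(5) by simp
        then have "card (S z) \<noteq> 0" using Zs[OF that] by linarith
        then have "S z \<noteq> {}" by auto
        then obtain e where "e \<in> S z" by blast
        then show ?thesis using S[of e z] c[of e] by auto
      qed
      have K: "card {z \<in> Z. u z = w} \<le> K" for w
      proof -
        have fin: "finite {z \<in> Z. u z = w}" using W(1) by (simp add: Z_def)
        \<comment> \<open>The sets \<open>S z\<close> are disjoint because a pair determines its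
          third vertex.\<close>
        have "(\<Sum>z\<in>{z \<in> Z. u z = w}. card (S z)) = card (\<Union>z\<in>{z \<in> Z. u z = w}. S z)"
          by (rule card_UN_disjoint[symmetric]) (use fin finS S in blast)+
        also have "\<dots> \<le> card (St w)" using SSt by (intro card_mono St) blast
        also have "\<dots> \<le> 2 * card W" by (rule St)
        finally have "(\<Sum>z\<in>{z \<in> Z. u z = w}. real (card (S z))) \<le> 2 * real (card W)"
          by (metis of_nat_le_iff of_nat_mult of_nat_numeral of_nat_sum)
        moreover have "(\<Sum>z\<in>{z \<in> Z. u z = w}. 2 * \<beta> * card W) \<le> (\<Sum>z\<in>{z \<in> Z. u z = w}. real (card (S z)))"
          by (intro sum_mono) (use Zs in auto)
        ultimately have "card {z \<in> Z. u z = w} * (2 * \<beta> * card W) \<le> 2 * real (card W)" by simp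
        then have "card {z \<in> Z. u z = w} * \<beta> \<le> 1" using W(5) by (simp add: mult.assoc[symmetric])
        then have "card {z \<in> Z. u z = w} \<le> 1 / \<beta>" using \<beta> by (simp add: field_simps)
        then show ?thesis unfolding K_def by linarith
      qed
      have "Z \<subseteq> W" by (auto simp: Z_def)
      moreover have "\<forall>z\<in>Z. u z \<noteq> z \<and> A z \<subseteq> W \<and> \<beta> * card W \<le> card (A z)" using uz AW cA by blast
      moreover have "\<forall>w. card {z \<in> Z. u z = w} \<le> K" using K by blast
      ultimately have "\<exists>J B. J \<subseteq> Z \<and> card J = card V \<and> inj_on u J \<and> u ` J \<inter> J = {} \<and>
        card B = card V \<and> (\<forall>z\<in>J. B \<subseteq> A z)"
        by (intro N2[OF W(1,4) _ Z])
      then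
      obtain J B where J: "J \<subseteq> Z" "card J = card V" "inj_on u J" "u ` J \<inter> J = {}" "card B = card V"
        "\<forall>z\<in>J. B \<subseteq> A z"
        by (elim exE conjE) (rule that; assumption)
      have "{u z, z, b} \<in> H" if "z \<in> J" "b \<in> B" for z b
      proof -
        have "b \<in> A z" using J(6) that by blast
        then have "(u z, b) \<in> S z \<or> (b, u z) \<in> S z" by (simp add: A_def)
        then obtain e where e: "e \<in> S z" "{fst e, snd e} = {u z, b}"
          by (metis fst_conv insert_commute snd_conv)
        have "g e = insert (c e) {fst e, snd e}" "c e = z" using S[OF e(1)] c[of e] by auto
        then have "g e = {u z, z, b}" unfolding e(2) by auto
        moreover have "g e \<in> H" using S[OF e(1)] D(3)[of "fst e" "snd e"] by auto
        ultimately show ?thesis by simp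
      qed
      then show ?thesis by (rule Berge_copy_from_stars[OF G(1-3,6-9) H J(2,5,3,4)])
    qed
  qed
qed

subsection \<open>The two extremal constructions\<close>

lemma not_Berge_freeE:
  assumes "\<not> Berge_free V E W H"
  obtains i f where "inj_on i V" "i ` V \<subseteq> W" "inj_on f E" "f ` E \<subseteq> H"
    "\<And>u v. {u, v} \<in> E \<Longrightarrow> i u \<in> f {u, v} \<and> i v \<in> f {u, v}"
proof -
  obtain W' H' where W': "subhypergraph W' H' W H" and "is_Berge V E W' H'"
    using assms unfolding Berge_free_def by blast
  then obtain i f where "inj_on i V" "i ` V \<subseteq> W'" "bij_betw f E H'"
    "\<forall>u v. {u, v} \<in> E \<longrightarrow> {i u, i v} \<subseteq> f {u, v}"
    unfolding is_Berge_def by blast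
  then show thesis using W' by (intro that[of i f]) (auto simp: subhypergraph_def bij_betw_def)
qed

lemma card_shadow_ge_biclique:
  assumes "finite W" "finite A" "finite B" "A \<inter> B = {}" "A \<subseteq> W" "B \<subseteq> W"
    "\<And>a b. a \<in> A \<Longrightarrow> b \<in> B \<Longrightarrow> \<exists>h\<in>H. {a, b} \<subseteq> h"
  shows "card A * card B \<le> card (shadow W H)"
proof -
  have "inj_on (\<lambda>(a, b). {a, b}) (A \<times> B)"
    using assms(4) by (auto simp: inj_on_def doubleton_eq_iff)
  then have "card A * card B = card ((\<lambda>(a, b). {a, b}) ` (A \<times> B))"
    by (simp add: card_image card_cartesian_product)
  also have "\<dots> \<le> card (shadow W H)"
  proof (rule card_mono)
    have "shadow W H \<subseteq> Pow W" by (auto simp: shadow_def)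
    then show "finite (shadow W H)" using assms(1) finite_subset by blast
    show "(\<lambda>(a, b). {a, b}) ` (A \<times> B) \<subseteq> shadow W H"
    proof safe
      fix a b assume ab: "a \<in> A" "b \<in> B"
      then have "a \<in> W" "b \<in> W" "a \<noteq> b" using assms(4-6) by auto
      then show "{a, b} \<in> shadow W H" using assms(7)[OF ab] unfolding shadow_def by blast
    qed
  qed
  finally show ?thesis .
qed

definition apex_edges :: "nat \<Rightarrow> nat set set" where
  "apex_edges m = {{0, a, b} | a b. 1 \<le> a \<and> a \<le> m \<and> m < b \<and> b \<le> 2 * m}"

text \<open>The doubled points are the residue classes modulo \<open>m\<close> below
  \<open>2 * m\<close>, and the tips are the vertices from \<open>2 * m\<close> on. Being in the
  same doubled point thus becomes a congruence.\<close>

definition doubled_edges :: "nat \<Rightarrow> nat set set" where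
  "doubled_edges m = {{a, m + a, b} | a b. a < m \<and> 2 * m \<le> b \<and> b < 3 * m}"

lemma apex_hypergraph:
  assumes "4 * m \<le> n"
  shows "three_graph {..<n} (apex_edges m)" "m\<^sup>2 \<le> card (shadow {..<n} (apex_edges m))"
proof -
  show "three_graph {..<n} (apex_edges m)"
    using assms by (auto simp: uniform_hypergraph_def apex_edges_def)
  have "card {1..m} * card {m<..2 * m} \<le> card (shadow {..<n} (apex_edges m))"
  proof (rule card_shadow_ge_biclique)
    fix a b assume "a \<in> {1..m}" "b \<in> {m<..2 * m}"
    then have "{0, a, b} \<in> apex_edges m" unfolding apex_edges_def by auto
    then show "\<exists>h\<in>apex_edges m. {a, b} \<subseteq> h" by blast
  qed (use assms in auto)
  then show "m\<^sup>2 \<le> card (shadow {..<n} (apex_edges m))" by (simp add: power2_eq_square)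
qed

lemma doubled_hypergraph:
  assumes "4 * m \<le> n"
  shows "three_graph {..<n} (doubled_edges m)" "m\<^sup>2 \<le> card (shadow {..<n} (doubled_edges m))"
proof -
  show "three_graph {..<n} (doubled_edges m)"
    using assms by (auto simp: uniform_hypergraph_def doubled_edges_def card_insert_if)
  have "card {..<m} * card {2 * m..<3 * m} \<le> card (shadow {..<n} (doubled_edges m))"
  proof (rule card_shadow_ge_biclique)
    fix a b assume "a \<in> {..<m}" "b \<in> {2 * m..<3 * m}"
    then have "{a, m + a, b} \<in> doubled_edges m" unfolding doubled_edges_def by auto
    then show "\<exists>h\<in>doubled_edges m. {a, b} \<subseteq> h" by blast
  qed (use assms in auto)
  then show "m\<^sup>2 \<le> card (shadow {..<n} (doubled_edges m))" by (simp add: power2_eq_square)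
qed

text \<open>In a copy of the graph, delete the vertex sent to 0. Every remaining edge has its ends
  sent to the two nonzero vertices of a hyperedge, which lie on different sides of the biclique, so
  the sides induce a bipartition.\<close>

lemma Berge_free_apex:
  assumes G: "simple_graph V E" "V \<noteq> {}" and no:
    "\<not> (\<exists>v\<in>V. bipartite (V - {v}) (induced_edges E (V - {v})))"
  shows "Berge_free V E W (apex_edges m)"
proof (rule ccontr)
  assume "\<not> Berge_free V E W (apex_edges m)"
  then obtain i f where i: "inj_on i V" and f: "f ` E \<subseteq> apex_edges m"
    "\<And>u v. {u, v} \<in> E \<Longrightarrow> i u \<in> f {u, v} \<and> i v \<in> f {u, v}"
    by (rule not_Berge_freeE) blast
  \<comment> \<open>If no vertex is sent to 0, any vertex may be deleted.\<close>
  obtain v where v: "v \<in> V" "\<And>a. a \<in> V - {v} \<Longrightarrow> i a \<noteq> 0"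
  proof (cases "0 \<in> i ` V")
    case True
    then obtain v where "v \<in> V" "i v = 0" by auto
    then show thesis using that[of v] i by (metis Diff_iff inj_onD singletonI)
  next
    case False
    then show thesis using that G(2) by fastforce
  qed
  define P where "P = {a \<in> V - {v}. i a \<le> m}"
  define Q where "Q = {a \<in> V - {v}. m < i a}"
  have "bipartition (V - {v}) (induced_edges E (V - {v})) P Q"
    unfolding bipartition_def
  proof (intro conjI ballI)
    show "P \<union> Q = V - {v}" "P \<inter> Q = {}" by (auto simp: P_def Q_def)
    fix e assume "e \<in> induced_edges E (V - {v})"
    then have e: "e \<in> E" "e \<subseteq> V - {v}" by (auto simp: induced_edges_def)
    then obtain a b where ab: "e = {a, b}" "a \<noteq> b"
      using G(1) by (auto simp: uniform_hypergraph_def card_2_iff)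
    have *: "i a \<noteq> i b" "i a \<noteq> 0" "i b \<noteq> 0" using ab e(2) v(2) i by (auto dest: inj_onD)
    have "f e \<in> apex_edges m" using f(1) e(1) by blast
    then obtain c d where "f e = {0, c, d}" "c \<le> m" "m < d" unfolding apex_edges_def by blast
    then have "i a \<le> m \<and> m < i b \<or> i b \<le> m \<and> m < i a" using f(2)[of a b] ab e(1) * by auto
    then show "\<exists>x\<in>P. \<exists>y\<in>Q. e = {x, y}" using ab(1) e(2) unfolding P_def Q_def by auto
  qed
  then show False using no v(1) unfolding bipartite_def by blast
qed

section \<open>Copies in the doubled biclique\<close>

lemma doubled_edges_same_pair:
  assumes "h \<in> doubled_edges m" "a \<in> h" "b \<in> h" "a < 2 * m" "b < 2 * m"
  shows "a mod m = b mod m"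
  using assms by (auto simp: doubled_edges_def)

lemma doubled_edges_same_tip:
  assumes "h \<in> doubled_edges m" "a \<in> h" "b \<in> h" "2 * m \<le> a" "2 * m \<le> b"
  shows "a = b"
  using assms by (auto simp: doubled_edges_def)

lemma doubled_edges_eqI:
  assumes "h \<in> doubled_edges m" "h' \<in> doubled_edges m" "a \<in> h" "a' \<in> h'" "b \<in> h" "b \<in> h'"
    "a < 2 * m" "a' < 2 * m" "2 * m \<le> b" "a mod m = a' mod m"
  shows "h = h'"
  using assms by (auto simp: doubled_edges_def)

lemma same_residue_below_double:
  assumes "a < 2 * m" "b < 2 * m" "c < 2 * m" "a mod m = b mod m" "a mod m = c mod (m :: nat)"
  shows "a = b \<or> b = c \<or> a = c"
proof -
  have "d mod m = (if d < m then d else d - m)" if "d < 2 * m" for d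
    using that by (simp add: mod_if)
  then show ?thesis using assms by (auto split: if_splits)
qed

text \<open>A hyperedge has a single tip, so at most one of the three vertices is a tip. If none is,
  all three lie in one residue class, which has only two elements. If one is, the other two are
  congruent, and the two hyperedges through the tip agree in residue and tip.\<close>

lemma doubled_edges_no_Berge_triangle:
  assumes h: "h1 \<in> doubled_edges m" "h2 \<in> doubled_edges m" "h3 \<in> doubled_edges m"
    and abc: "a \<in> h1" "b \<in> h1" "b \<in> h2" "c \<in> h2" "a \<in> h3" "c \<in> h3" "a \<noteq> b" "b \<noteq> c" "a \<noteq> c"
  shows "h1 = h2 \<or> h2 = h3 \<or> h1 = h3"
proof -
  have ab: "a < 2 * m \<or> b < 2 * m" using doubled_edges_same_tip[OF h(1), of a b] abc by linarith
  have bc: "b < 2 * m \<or> c < 2 * m" using doubled_edges_same_tip[OF h(2), of b c] abc by linarith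
  have ac: "a < 2 * m \<or> c < 2 * m" using doubled_edges_same_tip[OF h(3), of a c] abc by linarith
  note p = doubled_edges_same_pair[OF h(1) abc(1,2)] doubled_edges_same_pair[OF h(2) abc(3,4)]
    doubled_edges_same_pair[OF h(3) abc(5,6)]
  consider "a < 2 * m" "b < 2 * m" "c < 2 * m" | "a < 2 * m" "b < 2 * m" "2 * m \<le> c"
    | "a < 2 * m" "2 * m \<le> b" "c < 2 * m" | "2 * m \<le> a" "b < 2 * m" "c < 2 * m"
    using ab bc ac by linarith
  then show ?thesis
  proof cases
    case 1
    then show ?thesis using p same_residue_below_double[of a m b c] abc by simp
  next
    case 2
    then show ?thesis using p(1) doubled_edges_eqI[OF h(2,3) abc(3,5,4,6)] by simp
  next
    case 3
    then show ?thesis using p(3) doubled_edges_eqI[OF h(1,2) abc(1,4,2,3)] by simp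
  next
    case 4
    then show ?thesis using p(2) doubled_edges_eqI[OF h(1,3) abc(2,6,1,5)] by simp
  qed
qed

text \<open>Split the vertices of a copy by whether their images are base vertices or tips. No edge
  joins two vertices sent to tips. An edge inside \<open>U1\<close> joins the two elements of a
  residue class, so such edges form a matching.\<close>

lemma not_Berge_free_doubledD:
  assumes G: "simple_graph V E" and nf: "\<not> Berge_free V E W (doubled_edges m)"
  shows "triangle_free E"
    "\<exists>F U1 U2. F \<subseteq> E \<and> bipartition V F U1 U2 \<and> matching (E - F) \<and> (\<forall>e\<in>E - F. e \<subseteq> U1)"
proof -
  obtain i f where i: "inj_on i V" and f: "inj_on f E" "f ` E \<subseteq> doubled_edges m"
    "\<And>u v. {u, v} \<in> E \<Longrightarrow> i u \<in> f {u, v} \<and> i v \<in> f {u, v}"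
    using nf by (rule not_Berge_freeE) blast
  have fE: "f e \<in> doubled_edges m" if "e \<in> E" for e using f(2) that by blast
  have E: "e \<subseteq> V" "\<exists>a b. e = {a, b} \<and> a \<noteq> b" if "e \<in> E" for e
    using G that by (auto simp: uniform_hypergraph_def card_2_iff)
  have ieq: "a = b" if "i a = i b" "a \<in> V" "b \<in> V" for a b using i that by (auto dest: inj_onD)
  show "triangle_free E"
    unfolding triangle_free_def
  proof (intro notI, elim exE conjE)
    fix u v w assume d: "u \<noteq> v" "v \<noteq> w" "u \<noteq> w" and e: "{u, v} \<in> E" "{v, w} \<in> E" "{u, w} \<in> E"
    have "u \<in> V" "v \<in> V" "w \<in> V" using E(1)[OF e(1)] E(1)[OF e(2)] by auto
    then have "i u \<noteq> i v" "i v \<noteq> i w" "i u \<noteq> i w" using d ieq by metis+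
    then have "f {u, v} = f {v, w} \<or> f {v, w} = f {u, w} \<or> f {u, v} = f {u, w}"
      using doubled_edges_no_Berge_triangle[OF fE[OF e(1)] fE[OF e(2)] fE[OF e(3)], of "i u" "i v"
        "i w"]
        f(3)[OF e(1)] f(3)[OF e(2)] f(3)[OF e(3)] by blast
    then have "{u, v} = {v, w} \<or> {v, w} = {u, w} \<or> {u, v} = {u, w}"
      using inj_onD[OF f(1)] e by blast
    then show False using d by (auto simp: doubleton_eq_iff)
  qed
  define U1 where "U1 = {a \<in> V. i a < 2 * m}"
  define U2 where "U2 = {a \<in> V. 2 * m \<le> i a}"
  define F where "F = {e \<in> E. \<exists>a\<in>U1. \<exists>b\<in>U2. e = {a, b}}"
  have bip: "bipartition V F U1 U2" by (auto simp: bipartition_def F_def U1_def U2_def)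
  have sub: "e \<subseteq> U1" if e: "e \<in> E - F" for e
  proof -
    obtain a b where ab: "e = {a, b}" "a \<noteq> b" using E(2)[of e] e by blast
    have V: "a \<in> V" "b \<in> V" using E(1)[of e] e ab by auto
    have "i a < 2 * m \<or> i b < 2 * m"
      using doubled_edges_same_tip[OF fE[of e], of "i a" "i b"] f(3)[of a b] ieq[of a b] e ab V
        by fastforce
    moreover have "{a, b} = {b, a}" by auto
    ultimately have "i a < 2 * m \<and> i b < 2 * m" using e ab V unfolding F_def U1_def U2_def
      by (metis (mono_tags, lifting) DiffD1 DiffD2 linorder_not_less mem_Collect_eq)
    then show ?thesis using ab V by (auto simp: U1_def)
  qed
  have "disjoint (E - F)"
  proof (rule disjointI)
    fix e e' assume e: "e \<in> E - F" "e' \<in> E - F" "e \<noteq> e'"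
    show "e \<inter> e' = {}"
    proof (rule ccontr)
      assume "e \<inter> e' \<noteq> {}"
      then obtain a where a: "a \<in> e" "a \<in> e'" by blast
      have ex: "\<exists>b. d = {a, b} \<and> a \<noteq> b" if "d \<in> E" "a \<in> d" for d using E(2)[OF that(1)] that(2) by auto
      obtain b where b: "e = {a, b}" "a \<noteq> b" using ex[of e] e(1) a(1) by blast
      obtain c where c: "e' = {a, c}" "a \<noteq> c" using ex[of e'] e(2) a(2) by blast
      have V: "a \<in> V" "b \<in> V" "c \<in> V" and lt: "i a < 2 * m" "i b < 2 * m" "i c < 2 * m"
        using sub[OF e(1)] sub[OF e(2)] b c by (auto simp: U1_def)
      have "i a mod m = i b mod m"
        using doubled_edges_same_pair[OF fE[of e], of "i a" "i b"] f(3)[of a b] lt b e by auto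
      moreover have "i a mod m = i c mod m"
        using doubled_edges_same_pair[OF fE[of e'], of "i a" "i c"] f(3)[of a c] lt c e by auto
      ultimately have "i a = i b \<or> i b = i c \<or> i a = i c" using lt same_residue_below_double by blast
      then show False using ieq V b c e(3) by blast
    qed
  qed
  then show "\<exists>F U1 U2. F \<subseteq> E \<and> bipartition V F U1 U2 \<and> matching (E - F) \<and> (\<forall>e\<in>E - F. e \<subseteq> U1)"
    using bip sub unfolding matching_def by (intro exI[of _ F] exI[of _ U1] exI[of _ U2]) (auto simp: F_def)
qed

subsection \<open>The limit superior\<close>

lemma pi_shadow3_eq_0I:
  assumes small: "\<And>\<epsilon> :: real. \<epsilon> > 0 \<Longrightarrow> \<exists>N. \<forall>(W :: nat set) H. three_graph W H \<longrightarrow> N \<le> card W \<longrightarrow>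
      \<epsilon> * card W ^ 2 \<le> card (shadow W H) \<longrightarrow> \<not> Berge_free V E W H"
  shows "pi_shadow3 V E = 0"
proof -
  have "(\<lambda>n. real (ex_shadow3 V E n) / real (n choose 2)) \<longlonglongrightarrow> 0"
  proof (rule LIMSEQ_I)
    fix r :: real assume r: "r > 0"
    then obtain N where N: "\<And>(W :: nat set) H. three_graph W H \<Longrightarrow> N \<le> card W \<Longrightarrow> Berge_free V E W H \<Longrightarrow>
      \<not> r / 8 * card W ^ 2 \<le> card (shadow W H)"
      using small[of "r / 8"] by auto
    show "\<exists>no. \<forall>n\<ge>no. norm (real (ex_shadow3 V E n) / real (n choose 2) - 0) < r"
    proof (intro exI[of _ "N + 2"] allI impI)
      fix n assume n: "N + 2 \<le> n"
      have ex: "real (ex_shadow3 V E n) \<le> r / 8 * real n ^ 2"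
      proof (cases "shadow_sizes V E n = {}")
        case True
        then have "ex_shadow3 V E n = 0" by (simp add: ex_shadow3_def Sup_nat_def)
        then show ?thesis using r by simp
      next
        case False
        then have "ex_shadow3 V E n \<in> shadow_sizes V E n"
          using ex_shadow3_eq_Max finite_shadow_sizes Max_in by metis
        then obtain W :: "nat set" and H where "ex_shadow3 V E n = card (shadow W H)"
          "three_graph W H" "card W = n" "Berge_free V E W H"
          by (auto simp: shadow_sizes_def)
        then show ?thesis using N[of W H] n by simp
      qed
      have n2: "real (n choose 2) = real n * (real n - 1) / 2"
        using n by (simp add: choose_two real_of_nat_div of_nat_diff)
      have "real n * (real n / 2) \<le> real n * (real n - 1)" using n by (intro mult_left_mono) auto
      then have ge: "real n ^ 2 / 4 \<le> real (n choose 2)" using n2 by (simp add: power2_eq_square)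
      have cpos: "real (n choose 2) > 0" using n by (simp add: zero_less_binomial)
      have "real (ex_shadow3 V E n) \<le> r / 2 * (real n ^ 2 / 4)" using ex by simp
      also have "\<dots> \<le> r / 2 * real (n choose 2)" using ge r by (intro mult_left_mono) auto
      also have "\<dots> < r * real (n choose 2)" using r cpos by simp
      finally have "real (ex_shadow3 V E n) / real (n choose 2) < r"
        using cpos by (simp add: divide_less_eq)
      then show "norm (real (ex_shadow3 V E n) / real (n choose 2) - 0) < r" by simp
    qed
  qed
  then have "(\<lambda>n. ereal (real (ex_shadow3 V E n) / real (n choose 2))) \<longlonglongrightarrow> ereal 0" by simp
  then show ?thesis unfolding pi_shadow3_def by (simp add: lim_imp_Limsup zero_ereal_def)
qed

lemma pi_shadow3_neq_0I:
  assumes large: "\<And>n m. 4 * m \<le> n \<Longrightarrow> \<exists>(W :: nat set) H. three_graph W H \<and> card W = n \<and>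
    Berge_free V E W H \<and> m\<^sup>2 \<le> card (shadow W H)"
  shows "pi_shadow3 V E \<noteq> 0"
proof -
  have "1 / 32 \<le> real (ex_shadow3 V E n) / real (n choose 2)" if n: "n \<ge> 8" for n
  proof -
    define m where "m = n div 4"
    have "4 * m \<le> n" by (simp add: m_def)
    then obtain W :: "nat set" and H where W: "three_graph W H" "card W = n" "Berge_free V E W H"
      "m\<^sup>2 \<le> card (shadow W H)"
      using large by blast
    then have "card (shadow W H) \<in> shadow_sizes V E n" by (auto simp: shadow_sizes_def)
    then have "card (shadow W H) \<le> ex_shadow3 V E n"
      using ex_shadow3_eq_Max[of V E n] finite_shadow_sizes Max_ge by (metis empty_iff)
    then have m: "m\<^sup>2 \<le> ex_shadow3 V E n" using W(4) by linarith
    have "n \<le> 8 * m" using n by (simp add: m_def)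
    then have "real n / 8 \<le> real m" by simp
    then have "(real n / 8) ^ 2 \<le> real m ^ 2" by (intro power_mono) auto
    also have "\<dots> \<le> real (ex_shadow3 V E n)" using m by (metis of_nat_le_iff of_nat_power)
    finally have ex: "real n ^ 2 / 64 \<le> real (ex_shadow3 V E n)" by (simp add: power_divide)
    have n2: "real (n choose 2) = real n * (real n - 1) / 2"
      using n by (simp add: choose_two real_of_nat_div of_nat_diff)
    have "real n * (real n - 1) \<le> real n * real n" by (intro mult_left_mono) auto
    then have "real (n choose 2) \<le> real n ^ 2 / 2" using n2 by (simp add: power2_eq_square)
    then have "1 / 32 * real (n choose 2) \<le> real (ex_shadow3 V E n)" using ex by simp
    moreover have "real (n choose 2) > 0" using n by (simp add: zero_less_binomial)
    ultimately show ?thesis by (simp add: le_divide_eq)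
  qed
  then have "eventually (\<lambda>n. ereal (1 / 32) \<le> ereal (real (ex_shadow3 V E n) / real (n choose 2))) sequentially"
    unfolding eventually_sequentially ereal_less_eq by blast
  then have "ereal (1 / 32) \<le> pi_shadow3 V E" unfolding pi_shadow3_def by (intro le_Limsup) auto
  then show ?thesis by (auto simp: zero_ereal_def)
qed

theorem theorem3:
  fixes V :: "'a set" and E :: "'a set set"
  assumes "simple_graph V E" and "V \<noteq> {}"
  shows "pi_shadow3 V E = 0 \<longleftrightarrow>
    (triangle_free E \<and>
      (\<exists>v\<in>V. bipartite (V - {v}) (induced_edges E (V - {v})))) \<and>
    (\<exists>F U1 U2. F \<subseteq> E \<and> bipartition V F U1 U2 \<and> matching (E - F) \<and>
      ((\<forall>e\<in>E - F. e \<subseteq> U1) \<or> (\<forall>e\<in>E - F. e \<subseteq> U2)))"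
proof
  assume zero: "pi_shadow3 V E = 0"
  have "\<exists>v\<in>V. bipartite (V - {v}) (induced_edges E (V - {v}))"
  proof (rule ccontr)
    assume no: "\<not> ?thesis"
    have "pi_shadow3 V E \<noteq> 0"
    proof (rule pi_shadow3_neq_0I)
      fix n m :: nat assume "4 * m \<le> n"
      from apex_hypergraph[OF this] Berge_free_apex[OF assms no, of "{..<n}" m]
      show "\<exists>(W :: nat set) H. three_graph W H \<and> card W = n \<and> Berge_free V E W H \<and>
        m\<^sup>2 \<le> card (shadow W H)"
        by (intro exI[of _ "{..<n}"] exI[of _ "apex_edges m"]) simp
    qed
    then show False using zero by simp
  qed
  moreover have "\<exists>n m. 4 * m \<le> n \<and> \<not> Berge_free V E {..<n} (doubled_edges m)"
  proof (rule ccontr)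
    assume no: "\<not> ?thesis"
    have "pi_shadow3 V E \<noteq> 0"
    proof (rule pi_shadow3_neq_0I)
      fix n m :: nat assume nm: "4 * m \<le> n"
      then have "Berge_free V E {..<n} (doubled_edges m)" using no by blast
      with doubled_hypergraph[OF nm]
      show "\<exists>(W :: nat set) H. three_graph W H \<and> card W = n \<and> Berge_free V E W H \<and>
        m\<^sup>2 \<le> card (shadow W H)"
        by (intro exI[of _ "{..<n}"] exI[of _ "doubled_edges m"]) simp
    qed
    then show False using zero by simp
  qed
  ultimately show "(triangle_free E \<and> (\<exists>v\<in>V. bipartite (V - {v}) (induced_edges E (V - {v})))) \<and>
    (\<exists>F U1 U2. F \<subseteq> E \<and> bipartition V F U1 U2 \<and> matching (E - F) \<and>
      ((\<forall>e\<in>E - F. e \<subseteq> U1) \<or> (\<forall>e\<in>E - F. e \<subseteq> U2)))"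
    using not_Berge_free_doubledD[OF assms(1)] by metis
next
  assume "(triangle_free E \<and> (\<exists>v\<in>V. bipartite (V - {v}) (induced_edges E (V - {v})))) \<and>
    (\<exists>F U1 U2. F \<subseteq> E \<and> bipartition V F U1 U2 \<and> matching (E - F) \<and>
      ((\<forall>e\<in>E - F. e \<subseteq> U1) \<or> (\<forall>e\<in>E - F. e \<subseteq> U2)))"
  then obtain v F U1 U2 where G: "triangle_free E" "v \<in> V"
    "bipartite (V - {v}) (induced_edges E (V - {v}))"
    "F \<subseteq> E" "bipartition V F U1 U2" "matching (E - F)" "(\<forall>e\<in>E - F. e \<subseteq> U1) \<or> (\<forall>e\<in>E - F. e \<subseteq> U2)"
    by blast
  show "pi_shadow3 V E = 0"
    by (rule pi_shadow3_eq_0I) (rule dense_shadow_contains_Berge_copy[OF assms G])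
qed

end
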